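(* Let $(e_i)$ be a semi-normalized basic sequence in a Banach space. The following are equivalent: (a) every subsequence of $(e_i)$ contains a further subsequence which is equivalent to the unit vector basis of $c_0$ or of $\ell_p$ for some $1\le p<\infty$ (where $p$ may depend on the subsequence); (b) every subsequence of $(e_i)$ contains a further subsequence $(f_i)$ for which there exists $K>0$ such that for all $\alpha,\beta\in\operatorname{span}((f_i))$, $$\frac1K\|\alpha\|\,\|\beta\|\le\|\alpha\otimes\beta\|\le K\|\alpha\|\,\|\beta\|,$$ where $\otimes$ is the multiplication associated with $(f_i)$.
   Context: A sequence $(e_i)$ is semi-normalized if $0<\inf_i\|e_i\|\le\sup_i\|e_i\|<\infty$. $\operatorname{span}$ denotes the set of finite linear combinations. For any semi-normalized basic sequence $(f_i)$, the multiplication $\otimes$ associated with $(f_i)$ on $\operatorname{span}((f_i))$ is defined as follows: for $\alpha=\sum_{i=1}^n a_if_i$ and $\beta=\sum_{j=1}^m b_jf_j$ with $b_m\ne0$, $$\alpha\otimes\beta=\sum_{i=1}^n a_i\Big(\sum_{j=1}^m b_j f_{(i-1)m+j}\Big),$$ and $\alpha\otimes 0=0$. The multiplication depends on the basic sequence: for a subsequence $(f_i)$ of $(e_i)$ it is computed with the indexing of $(f_i)$, not that of $(e_i)$. The constant $K$ may depend on the subsequence. Two basic sequences $(x_i)$, $(y_i)$ are equivalent if there is $C>0$ with $\frac1C\|\sum a_ix_i\|\le\|\sum a_iy_i\|\le C\|\sum a_ix_i\|$ for all finitely supported scalar sequences $(a_i)$. *)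

theory Defs
  imports "HOL-Analysis.Analysis" "HOL-Library.Function_Algebras"
begin

text \<open>Pointwise scalar multiplication of functions; with it, scalar sequences of type
  \<^typ>\<open>nat \<Rightarrow> real\<close> form a real vector space.\<close>

instantiation "fun" :: (type, real_vector) real_vector
begin

definition scaleR_fun :: "real \<Rightarrow> ('a \<Rightarrow> 'b) \<Rightarrow> 'a \<Rightarrow> 'b"
  where "scaleR_fun c x = (\<lambda>k. c *\<^sub>R x k)"

instance
  by standard (simp_all add: scaleR_fun_def fun_eq_iff scaleR_add_right scaleR_add_left)

end

definition semi_normalized :: "(nat \<Rightarrow> 'a::real_normed_vector) \<Rightarrow> bool"
  where "semi_normalized e \<longleftrightarrow>
    0 < (INF i. norm (e i)) \<and> bdd_above (range (\<lambda>i. norm (e i)))"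

text \<open>A basic sequence is a Schauder basis of its closed linear span.\<close>

definition basic_sequence :: "(nat \<Rightarrow> 'a::real_normed_vector) \<Rightarrow> bool"
  where "basic_sequence e \<longleftrightarrow>
    (\<forall>x \<in> closure (span (range e)). \<exists>!a :: nat \<Rightarrow> real. (\<lambda>i. a i *\<^sub>R e i) sums x)"

text \<open>The norms \<open>N\<close> and \<open>M\<close> are explicit arguments because the spaces \<open>\<ell>\<^sub>p\<close> and \<open>c\<^sub>0\<close>
  are all made up of elements of the one type \<^typ>\<open>nat \<Rightarrow> real\<close>.\<close>

definition equivalent_sequences ::
    "('a::real_vector \<Rightarrow> real) \<Rightarrow> (nat \<Rightarrow> 'a) \<Rightarrow> ('b::real_vector \<Rightarrow> real) \<Rightarrow> (nat \<Rightarrow> 'b) \<Rightarrow> bool"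
  where "equivalent_sequences N x M y \<longleftrightarrow>
    (\<exists>C>0. \<forall>a :: nat \<Rightarrow> real. finite {i. a i \<noteq> 0} \<longrightarrow>
      1 / C * N (\<Sum>i | a i \<noteq> 0. a i *\<^sub>R x i) \<le> M (\<Sum>i | a i \<noteq> 0. a i *\<^sub>R y i) \<and>
      M (\<Sum>i | a i \<noteq> 0. a i *\<^sub>R y i) \<le> C * N (\<Sum>i | a i \<noteq> 0. a i *\<^sub>R x i))"

definition unit_vector :: "nat \<Rightarrow> nat \<Rightarrow> real"
  where "unit_vector i = (\<lambda>k. if k = i then 1 else 0)"

definition lp_norm :: "real \<Rightarrow> (nat \<Rightarrow> real) \<Rightarrow> real"
  where "lp_norm p x = (\<Sum>k. \<bar>x k\<bar> powr p) powr (1 / p)"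

definition c0_norm :: "(nat \<Rightarrow> real) \<Rightarrow> real"
  where "c0_norm x = (SUP k. \<bar>x k\<bar>)"

text \<open>The coefficient of \<open>f i\<close> in the expansion of \<open>v\<close>, for \<open>v\<close> in the span of a linearly
  independent injective sequence \<open>f\<close>.\<close>

definition coord :: "(nat \<Rightarrow> 'a::real_vector) \<Rightarrow> 'a \<Rightarrow> nat \<Rightarrow> real"
  where "coord f v i = representation (range f) v (f i)"

text \<open>One more than the last index carrying a nonzero coefficient, and \<open>0\<close> for the zero vector.\<close>

definition supp_length :: "(nat \<Rightarrow> 'a::real_vector) \<Rightarrow> 'a \<Rightarrow> nat"
  where "supp_length f v = (LEAST m. \<forall>i\<ge>m. coord f v i = 0)"

text \<open>Indices start at \<open>0\<close> here, so the index \<open>(i - 1) m + j\<close> of the usual definition,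
  for \<open>i, j \<ge> 1\<close>, becomes \<open>i m + j\<close>.  For \<open>\<beta> = 0\<close> the inner sum is empty and the product is \<open>0\<close>.\<close>

definition block_mult :: "(nat \<Rightarrow> 'a::real_vector) \<Rightarrow> 'a \<Rightarrow> 'a \<Rightarrow> 'a"
  where "block_mult f \<alpha> \<beta> =
    (\<Sum>i<supp_length f \<alpha>. coord f \<alpha> i *\<^sub>R
      (\<Sum>j<supp_length f \<beta>. coord f \<beta> j *\<^sub>R f (i * supp_length f \<beta> + j)))"

lemma basic_sequence_finite_zero:
  assumes "basic_sequence f" "finite I" "(\<Sum>i\<in>I. a i *\<^sub>R f i) = 0" "i \<in> I"
  shows "a i = 0"
proof -
  define b where "b i = (if i \<in> I then a i else 0)" for i
  have "(\<lambda>i. b i *\<^sub>R f i) sums (\<Sum>i\<in>I. b i *\<^sub>R f i)"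
    using assms(2) by (intro sums_finite) (auto simp: b_def)
  also have "(\<Sum>i\<in>I. b i *\<^sub>R f i) = (\<Sum>i\<in>I. a i *\<^sub>R f i)"
    by (intro sum.cong) (auto simp: b_def)
  finally have 1: "(\<lambda>i. b i *\<^sub>R f i) sums 0" using assms(3) by simp
  have 2: "(\<lambda>i. (0::real) *\<^sub>R f i) sums 0" by simp
  have "0 \<in> closure (span (range f))"
    using closure_subset span_zero by blast
  then have "\<exists>!a :: nat \<Rightarrow> real. (\<lambda>i. a i *\<^sub>R f i) sums 0"
    using assms(1) by (auto simp: basic_sequence_def)
  then have "b = (\<lambda>i. 0)" by (rule Uniq_D[OF ex1_iff_ex_Uniq[THEN iffD1, THEN conjunct2]]) (rule 1, rule 2)
  from fun_cong[OF this, of i] show ?thesis using assms(4) by (simp add: b_def)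
qed

lemma basic_sequence_inj:
  assumes "basic_sequence f"
  shows "inj f"
proof (rule injI, rule ccontr)
  fix i j assume ij: "f i = f j" "i \<noteq> j"
  have "(\<Sum>k\<in>{i, j}. (if k = i then 1 else -1 :: real) *\<^sub>R f k) = 0"
    using ij by simp
  from basic_sequence_finite_zero[OF assms _ this, of i] show False by simp
qed

lemma basic_sequence_independent:
  assumes "basic_sequence f"
  shows "independent (range f)"
  unfolding independent_explicit_finite_subsets
proof (intro allI impI ballI)
  fix S u v
  assume S: "S \<subseteq> range f" "finite S" "(\<Sum>v\<in>S. u v *\<^sub>R v) = 0" "v \<in> S"
  have inj: "inj f" by (rule basic_sequence_inj[OF assms])
  define I where "I = f -` S"
  have SI: "S = f ` I" using S(1) by (auto simp: I_def)
  have fin: "finite I" unfolding I_def using S(2) inj by (rule finite_vimageI)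
  have "(\<Sum>i\<in>I. u (f i) *\<^sub>R f i) = 0"
    using S(3) unfolding SI
    by (subst (asm) sum.reindex) (auto intro: inj_on_subset[OF inj])
  from basic_sequence_finite_zero[OF assms fin this] S(4) show "u v = 0"
    unfolding SI by auto
qed

lemma coord_sum:
  assumes "basic_sequence f"
  shows "coord f (\<Sum>i<n. a i *\<^sub>R f i) k = (if k < n then a k else 0)"
proof -
  have ind: "independent (range f)" by (rule basic_sequence_independent[OF assms])
  have inj: "inj f" by (rule basic_sequence_inj[OF assms])
  have "coord f (\<Sum>i<n. a i *\<^sub>R f i) k
      = (\<Sum>i<n. a i * representation (range f) (f i) (f k))"
    unfolding coord_def
    by (subst representation_sum[OF ind])
      (auto simp: representation_scale[OF ind] span_base span_scale)
  also have "\<dots> = (\<Sum>i<n. if i = k then a i else 0)"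
    by (intro sum.cong) (auto simp: representation_basis[OF ind] inj_eq[OF inj])
  finally show ?thesis by simp
qed

text \<open>On explicit expansions, \<^const>\<open>block_mult\<close> is given by the defining formula of the
  multiplication.\<close>

lemma block_mult_sum:
  assumes f: "basic_sequence f" and m: "m > 0" "b (m - 1) \<noteq> 0"
  shows "block_mult f (\<Sum>i<n. a i *\<^sub>R f i) (\<Sum>j<m. b j *\<^sub>R f j)
    = (\<Sum>i<n. a i *\<^sub>R (\<Sum>j<m. b j *\<^sub>R f (i * m + j)))"
proof -
  let ?\<alpha> = "\<Sum>i<n. a i *\<^sub>R f i" and ?\<beta> = "\<Sum>j<m. b j *\<^sub>R f j"
  have \<beta>: "supp_length f ?\<beta> = m"
    unfolding supp_length_def coord_sum[OF f]
  proof (rule Least_equality)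
    fix y assume y: "\<forall>i\<ge>y. (if i < m then b i else 0) = 0"
    show "m \<le> y"
    proof (rule ccontr)
      assume "\<not> m \<le> y"
      then have "y \<le> m - 1" "m - 1 < m" by auto
      with y m(2) show False by (metis (full_types))
    qed
  qed auto
  let ?l = "supp_length f ?\<alpha>"
  have le: "?l \<le> n"
    unfolding supp_length_def coord_sum[OF f] by (rule Least_le) auto
  have "\<forall>i\<ge>?l. coord f ?\<alpha> i = 0"
    unfolding supp_length_def by (rule LeastI[of _ n]) (simp add: coord_sum[OF f])
  then have z: "a i = 0" if "?l \<le> i" "i < n" for i
    using that by (auto simp: coord_sum[OF f])
  have "block_mult f ?\<alpha> ?\<beta> = (\<Sum>i<?l. a i *\<^sub>R (\<Sum>j<m. b j *\<^sub>R f (i * m + j)))"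
    unfolding block_mult_def \<beta> using le
    by (intro sum.cong refl arg_cong2[where f = scaleR]) (auto simp: coord_sum[OF f])
  also have "\<dots> = (\<Sum>i<n. a i *\<^sub>R (\<Sum>j<m. b j *\<^sub>R f (i * m + j)))"
    using le z by (intro sum.mono_neutral_left) auto
  finally show ?thesis .
qed

lemma block_mult_zero_right: "block_mult f \<alpha> 0 = 0"
proof -
  have "supp_length f 0 = 0"
    unfolding supp_length_def coord_def by (simp add: representation_zero)
  then show ?thesis by (simp add: block_mult_def)
qed

end

theory Submission
  imports Defs "HOL-Library.Ramsey" "HOL-Library.Diagonal_Subsequence"
begin

text \<open>The norms of \<open>\<ell>\<^sub>p\<close> and \<open>c\<^sub>0\<close> are exactly multiplicative on the unit vector basis, which gives one
  direction.  Conversely, by Ramsey's theorem one may first pass to a subsequence along which the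
  norms of \<open>\<Sum>i<k. a\<^sub>i f\<^bsub>n\<^sub>i\<^esub>\<close> converge as \<open>n\<^sub>0 < \<dots> < n\<^bsub>k-1\<^esub>\<close> tend to infinity.  Multiplying by a
  single \<open>f\<^bsub>m-1\<^esub>\<close> shows that \<open>f\<close> is equivalent to \<open>f\<^bsub>im+m-1\<^esub>\<close> uniformly in \<open>m\<close>; letting \<open>m\<close> tend to
  infinity, \<open>f\<close> is uniformly equivalent to all its subsequences.  Multiplying by \<open>f\<^sub>0 - f\<^sub>1\<close> shows that
  \<open>f\<close> is equivalent to a sequence of differences and therefore unconditional.  The norms of
  \<open>f\<^sub>0 + \<dots> + f\<^bsub>n-1\<^esub>\<close> are quasi-multiplicative in \<open>n\<close>, hence comparable to \<open>n\<^sup>s\<close> for some \<open>0 \<le> s \<le> 1\<close>.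
  Finally, following Aubrun and Nechita, the \<open>k\<close>-th tensor power of a vector \<open>x\<close> of length \<open>n\<close> has at
  most \<open>(k + 1)\<^sup>n\<close> distinct coefficients; computing its norm up to polynomial factors on the sets where
  it is constant and taking \<open>k\<close>-th roots compares the norm of \<open>x\<close> with its \<open>\<ell>\<^sub>p\<close> norm, \<open>p = 1 / s\<close>
  (\<open>c\<^sub>0\<close> if \<open>s = 0\<close>).\<close>

section \<open>Sequences with stabilising spread norms\<close>

text \<open>Cauchy form of the convergence of the spread norms as all indices tend to infinity, that
  is, of the existence of a spreading model, without naming the limit norm. Only the values of
  \<open>n\<close> below \<open>k\<close> count.\<close>

definition spread_stable :: "(nat \<Rightarrow> 'a::real_normed_vector) \<Rightarrow> bool"
  where "spread_stable g \<longleftrightarrow> (\<forall>k (a :: nat \<Rightarrow> real). \<forall>\<epsilon>>0. \<exists>M. \<forall>n n'.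
    strict_mono_on {..<k} n \<longrightarrow> strict_mono_on {..<k} n' \<longrightarrow> (\<forall>i<k. M \<le> n i \<and> M \<le> n' i) \<longrightarrow>
    \<bar>norm (\<Sum>i<k. a i *\<^sub>R g (n i)) - norm (\<Sum>i<k. a i *\<^sub>R g (n' i))\<bar> < \<epsilon>)"

lemma strict_mono_on_compose:
  fixes s :: "nat \<Rightarrow> nat"
  assumes "strict_mono_on A n" "strict_mono s"
  shows "strict_mono_on A (\<lambda>i. s (n i))"
  using assms by (auto simp: strict_mono_on_def strict_mono_def)

lemma spread_stable_subseq:
  assumes g: "spread_stable g" and s: "strict_mono s"
  shows "spread_stable (g \<circ> s)"
  unfolding spread_stable_def
proof (intro allI impI)
  fix k :: nat and a :: "nat \<Rightarrow> real" and \<epsilon> :: real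
  assume "\<epsilon> > 0"
  then obtain M where M: "\<forall>n n'. strict_mono_on {..<k} n \<longrightarrow> strict_mono_on {..<k} n' \<longrightarrow>
      (\<forall>i<k. M \<le> n i \<and> M \<le> n' i) \<longrightarrow>
      \<bar>norm (\<Sum>i<k. a i *\<^sub>R g (n i)) - norm (\<Sum>i<k. a i *\<^sub>R g (n' i))\<bar> < \<epsilon>"
    using g unfolding spread_stable_def by presburger
  show "\<exists>M. \<forall>n n'. strict_mono_on {..<k} n \<longrightarrow> strict_mono_on {..<k} n' \<longrightarrow>
      (\<forall>i<k. M \<le> n i \<and> M \<le> n' i) \<longrightarrow>
      \<bar>norm (\<Sum>i<k. a i *\<^sub>R (g \<circ> s) (n i)) - norm (\<Sum>i<k. a i *\<^sub>R (g \<circ> s) (n' i))\<bar> < \<epsilon>"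
  proof (intro exI[of _ M] allI impI)
    fix n n' :: "nat \<Rightarrow> nat"
    assume n: "strict_mono_on {..<k} n" "strict_mono_on {..<k} n'" "\<forall>i<k. M \<le> n i \<and> M \<le> n' i"
    have ge: "M \<le> s (n i)" "M \<le> s (n' i)" if "i < k" for i
      using n(3) that seq_suble[OF s, of "n i"] seq_suble[OF s, of "n' i"] by (meson le_trans)+
    show "\<bar>norm (\<Sum>i<k. a i *\<^sub>R (g \<circ> s) (n i)) - norm (\<Sum>i<k. a i *\<^sub>R (g \<circ> s) (n' i))\<bar> < \<epsilon>"
      unfolding o_def
      by (rule M[rule_format, OF strict_mono_on_compose[OF n(1) s] strict_mono_on_compose[OF n(2) s]])
        (simp add: ge)
  qed
qed

text \<open>Recovers an increasing tuple from its range, so that a colouring of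
  \<open>k\<close>-element sets can speak about tuples.\<close>

lemma rank_in_strict_mono_image:
  fixes n :: "nat \<Rightarrow> nat"
  assumes "strict_mono_on {..<k} n" "i < k"
  shows "card {y \<in> n ` {..<k}. y < n i} = i"
proof -
  have lt: "n j < n i \<longleftrightarrow> j < i" if "j < k" for j
    using strict_mono_on_less[OF assms(1), of j i] that assms(2) by simp
  have "{y \<in> n ` {..<k}. y < n i} = n ` {..<i}"
    using assms(2) by (auto simp: lt)
  moreover have "inj_on n {..<i}"
    using strict_mono_on_imp_inj_on[OF assms(1)] by (rule inj_on_subset) (use assms(2) in auto)
  ultimately show ?thesis by (simp add: card_image)
qed

text \<open>Colour each \<open>k\<close>-element set by the cell of width \<open>\<delta>\<close>
  that contains the value of \<open>F\<close> at its increasing enumeration. Boundedness leaves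
  finitely many colours, and \<open>r\<close> enumerates an infinite homogeneous set.\<close>

lemma Ramsey_bounded_function:
  fixes F :: "(nat \<Rightarrow> nat) \<Rightarrow> real"
  assumes cong: "\<And>n n'. (\<And>i. i < k \<Longrightarrow> n i = n' i) \<Longrightarrow> F n = F n'"
    and bound: "\<And>n. \<bar>F n\<bar> \<le> B" and "\<delta> > 0"
  shows "\<exists>r :: nat \<Rightarrow> nat. strict_mono r \<and> (\<forall>n n'. strict_mono_on {..<k} n \<longrightarrow> strict_mono_on {..<k} n' \<longrightarrow>
    \<bar>F (\<lambda>i. r (n i)) - F (\<lambda>i. r (n' i))\<bar> < \<delta>)"
proof -
  define enum :: "nat set \<Rightarrow> nat \<Rightarrow> nat"
    where "enum X i = (THE x. x \<in> X \<and> card {y \<in> X. y < x} = i)" for X i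
  have enum: "enum (n ` {..<k}) i = n i" if n: "strict_mono_on {..<k} n" and "i < k" for n i
    unfolding enum_def
    by (rule the_equality) (use rank_in_strict_mono_image[OF n] that in auto)
  define col where "col X = nat \<lfloor>(F (enum X) + B) / \<delta>\<rfloor>" for X
  \<comment> \<open>Cells are counted from \<open>-B\<close> upwards, so the largest index is the
    floor of \<open>(B + B) / \<delta>\<close>; \<open>Suc\<close> makes the bound strict.\<close>
  define m where "m = Suc (nat \<lfloor>(B + B) / \<delta>\<rfloor>)"
  have "col X < m" for X
    unfolding col_def m_def less_Suc_eq_le using bound[of "enum X"] \<open>\<delta> > 0\<close>
    by (intro nat_mono floor_mono divide_right_mono) auto
  then obtain Y t where Y: "infinite Y" and t: "\<And>X. X \<subseteq> Y \<Longrightarrow> finite X \<Longrightarrow> card X = k \<Longrightarrow> col X = t"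
    using Ramsey[of "UNIV :: nat set" k col m] by auto
  show ?thesis
  proof (intro exI[of _ "enumerate Y"] conjI allI impI)
    show r: "strict_mono (enumerate Y)" by (rule strict_mono_enumerate[OF Y])
    fix n n' :: "nat \<Rightarrow> nat" assume n: "strict_mono_on {..<k} n" "strict_mono_on {..<k} n'"
    have *: "(F (\<lambda>i. enumerate Y (n i)) + B) / \<delta> < real t + 1"
      "real t \<le> (F (\<lambda>i. enumerate Y (n i)) + B) / \<delta>" if n: "strict_mono_on {..<k} n" for n :: "nat \<Rightarrow> nat"
    proof -
      let ?n = "\<lambda>i. enumerate Y (n i)"
      have sm: "strict_mono_on {..<k} ?n" by (rule strict_mono_on_compose[OF n r])
      have "col (?n ` {..<k}) = t"
        using Y by (intro t) (auto simp: enumerate_in_set card_image[OF strict_mono_on_imp_inj_on[OF sm]])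
      moreover have "F (enum (?n ` {..<k})) = F ?n"
        by (rule cong) (rule enum[OF sm])
      ultimately have "nat \<lfloor>(F ?n + B) / \<delta>\<rfloor> = t" by (simp add: col_def)
      moreover have "0 \<le> (F ?n + B) / \<delta>" using bound[of ?n] \<open>\<delta> > 0\<close> by (intro divide_nonneg_pos) auto
      ultimately show "(F ?n + B) / \<delta> < real t + 1" "real t \<le> (F ?n + B) / \<delta>" by linarith+
    qed
    have "\<bar>(F (\<lambda>i. enumerate Y (n i)) + B) / \<delta> - (F (\<lambda>i. enumerate Y (n' i)) + B) / \<delta>\<bar> < 1"
      using *[OF n(1)] *[OF n(2)] by linarith
    then show "\<bar>F (\<lambda>i. enumerate Y (n i)) - F (\<lambda>i. enumerate Y (n' i))\<bar> < \<delta>"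
      using \<open>\<delta> > 0\<close> by (simp add: diff_divide_distrib[symmetric])
  qed
qed

lemma norm_sum_scaleR_le:
  fixes g :: "nat \<Rightarrow> 'a::real_normed_vector"
  assumes "\<And>i. norm (g i) \<le> S"
  shows "norm (\<Sum>i\<in>I. a i *\<^sub>R g (n i)) \<le> (\<Sum>i\<in>I. \<bar>a i\<bar>) * S"
  unfolding sum_distrib_right
  by (rule order_trans[OF norm_sum]) (auto intro!: sum_mono mult_left_mono assms)

text \<open>Ramsey's theorem handles one coefficient tuple and one tolerance. Diagonalising over the
  countably many rational tuples and tolerances \<open>1 / Suc j\<close> covers all of them, and
  boundedness of \<open>e\<close> passes from rational to real coefficients.\<close>

lemma spread_stable_subsequence_exists:
  fixes e :: "nat \<Rightarrow> 'a::real_normed_vector"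
  assumes S: "\<And>i. norm (e i) \<le> S"
  obtains u where "strict_mono u" "spread_stable (e \<circ> u)"
proof -
  define F :: "rat list \<Rightarrow> (nat \<Rightarrow> nat) \<Rightarrow> real" where "F l n = norm (\<Sum>i<length l. real_of_rat (l ! i) *\<^sub>R e (n i))" for l n
  \<comment> \<open>The number \<open>q\<close> encodes a list of rational coefficients together
    with a tolerance.\<close>
  define P where "P q s \<longleftrightarrow> (case from_nat q :: rat list \<times> nat of (l, j) \<Rightarrow>
      \<forall>n n'. strict_mono_on {..<length l} n \<longrightarrow> strict_mono_on {..<length l} n' \<longrightarrow>
        \<bar>F l (\<lambda>i. s (n i)) - F l (\<lambda>i. s (n' i))\<bar> < 1 / real (Suc j))" for q and s :: "nat \<Rightarrow> nat"
  interpret subseqs P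
  proof
    fix q and s :: "nat \<Rightarrow> nat" assume "strict_mono s"
    obtain l :: "rat list" and j :: nat where lj: "from_nat q = (l, j)" by fastforce
    let ?B = "(\<Sum>i<length l. \<bar>real_of_rat (l ! i)\<bar>) * S"
    have "\<exists>r :: nat \<Rightarrow> nat. strict_mono r \<and> (\<forall>n n'. strict_mono_on {..<length l} n \<longrightarrow> strict_mono_on {..<length l} n' \<longrightarrow>
      \<bar>F l (\<lambda>i. s (r (n i))) - F l (\<lambda>i. s (r (n' i)))\<bar> < 1 / real (Suc j))"
    proof (rule Ramsey_bounded_function[of "length l" "\<lambda>n. F l (\<lambda>i. s (n i))" ?B "1 / real (Suc j)"])
      show "\<bar>F l (\<lambda>i. s (n i))\<bar> \<le> ?B" for n
        unfolding F_def using norm_sum_scaleR_le[where g = e and n = "\<lambda>i. s (n i)", OF S] by (simp del: abs_of_rat)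
    qed (auto simp: F_def)
    then show "\<exists>r'. strict_mono r' \<and> P q (s \<circ> r')"
      unfolding P_def lj by auto
  qed
  \<comment> \<open>The \<open>q\<close>-th property is secured for the tail of the diagonal
    sequence starting at \<open>Suc q\<close>; hence the threshold \<open>Suc q\<close>
    below.\<close>
  have hold: "P q (diagseq \<circ> (+) (Suc q))" for q
  proof (rule diagseq_holds)
    fix r s n assume r: "strict_mono (r :: nat \<Rightarrow> nat)" and "P n s"
    then show "P n (s \<circ> r)"
      unfolding P_def by (auto split: prod.splits dest: strict_mono_on_compose[OF _ r])
  qed
  have "spread_stable (e \<circ> diagseq)"
    unfolding spread_stable_def
  proof (intro allI impI)
    fix k :: nat and a :: "nat \<Rightarrow> real" and \<epsilon> :: real
    assume \<epsilon>: "\<epsilon> > 0"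
    have S0: "S \<ge> 0" using order_trans[OF norm_ge_zero S] .
    \<comment> \<open>Perturbing \<open>k\<close> coefficients by \<open>\<eta>\<close> changes the
      norm by at most \<open>\<epsilon> / 4\<close>; two such errors and a tolerance below
      \<open>\<epsilon> / 2\<close> stay below \<open>\<epsilon>\<close>. Adding 1 keeps the
      denominator positive.\<close>
    define \<eta> where "\<eta> = \<epsilon> / 4 / (real k * S + 1)"
    have kS: "real k * S + 1 > 0" using S0 by (simp add: add_nonneg_pos)
    have \<eta>: "\<eta> > 0" unfolding \<eta>_def using \<epsilon> kS by simp
    have "\<exists>b :: rat. \<bar>real_of_rat b - a i\<bar> < \<eta>" for i
      using of_rat_dense[of "a i - \<eta>" "a i + \<eta>"] \<eta> by (auto simp: abs_less_iff algebra_simps)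
    then obtain b :: "nat \<Rightarrow> rat" where b: "\<And>i. \<bar>real_of_rat (b i) - a i\<bar> < \<eta>" by metis
    obtain j where j: "1 / real (Suc j) < \<epsilon> / 2"
      using \<epsilon> nat_approx_posE[of "\<epsilon> / 2"] by auto
    define l where "l = map b [0..<k]"
    have [simp]: "length l = k" by (simp add: l_def)
    define q where "q = to_nat (l, j)"
    have close: "\<bar>norm (\<Sum>i<k. a i *\<^sub>R e (n i)) - F l n\<bar> \<le> \<epsilon> / 4" for n
    proof -
      have "F l n = norm (\<Sum>i<k. real_of_rat (b i) *\<^sub>R e (n i))"
        unfolding F_def by (simp add: l_def)
      then have "\<bar>norm (\<Sum>i<k. a i *\<^sub>R e (n i)) - F l n\<bar>
          \<le> norm (\<Sum>i<k. (a i - real_of_rat (b i)) *\<^sub>R e (n i))"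
        by (simp add: norm_triangle_ineq3 scaleR_left_diff_distrib sum_subtractf)
      also have "\<dots> \<le> (\<Sum>i<k. \<bar>a i - real_of_rat (b i)\<bar>) * S" by (rule norm_sum_scaleR_le[OF S])
      also have "\<dots> \<le> (\<Sum>i<k. \<eta>) * S"
        using b S0 by (intro mult_right_mono sum_mono) (auto simp: abs_minus_commute less_imp_le)
      also have "\<dots> = \<eta> * (real k * S)" by simp
      also have "\<dots> \<le> \<eta> * (real k * S + 1)" using \<eta> by (intro mult_left_mono) auto
      also have "\<dots> = \<epsilon> / 4"
        using nonzero_eq_divide_eq[of "real k * S + 1" \<eta> "\<epsilon> / 4"] kS \<eta>_def by auto
      finally show ?thesis .
    qed
    show "\<exists>M. \<forall>n n'. strict_mono_on {..<k} n \<longrightarrow> strict_mono_on {..<k} n' \<longrightarrow>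
      (\<forall>i<k. M \<le> n i \<and> M \<le> n' i) \<longrightarrow>
      \<bar>norm (\<Sum>i<k. a i *\<^sub>R (e \<circ> diagseq) (n i)) - norm (\<Sum>i<k. a i *\<^sub>R (e \<circ> diagseq) (n' i))\<bar> < \<epsilon>"
    proof (intro exI[of _ "Suc q"] allI impI)
      fix n n' :: "nat \<Rightarrow> nat"
      assume n: "strict_mono_on {..<k} n" "strict_mono_on {..<k} n'" "\<forall>i<k. Suc q \<le> n i \<and> Suc q \<le> n' i"
      have mono: "strict_mono_on {..<k} (\<lambda>i. n i - Suc q)" "strict_mono_on {..<k} (\<lambda>i. n' i - Suc q)"
        using n by (auto simp: strict_mono_on_def intro!: diff_less_mono)
      have eq: "F l (\<lambda>i. (diagseq \<circ> (+) (Suc q)) (n i - Suc q)) = F l (\<lambda>i. diagseq (n i))"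
        "F l (\<lambda>i. (diagseq \<circ> (+) (Suc q)) (n' i - Suc q)) = F l (\<lambda>i. diagseq (n' i))"
        unfolding F_def using n(3)
        by (auto intro!: arg_cong[of _ _ norm] sum.cong arg_cong[of _ _ e] arg_cong[of _ _ diagseq])
      have "\<bar>F l (\<lambda>i. diagseq (n i)) - F l (\<lambda>i. diagseq (n' i))\<bar> < 1 / real (Suc j)"
        using hold[of q] mono unfolding P_def q_def[symmetric] eq[symmetric]
        by (simp add: q_def)
      with j close[of "\<lambda>i. diagseq (n i)"] close[of "\<lambda>i. diagseq (n' i)"]
      show "\<bar>norm (\<Sum>i<k. a i *\<^sub>R (e \<circ> diagseq) (n i)) - norm (\<Sum>i<k. a i *\<^sub>R (e \<circ> diagseq) (n' i))\<bar> < \<epsilon>"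
        unfolding o_def by linarith
    qed
  qed
  then show ?thesis using that subseq_diagseq by blast
qed

section \<open>Quasi-multiplicative growth\<close>

lemma nonpos_if_multiples_bounded:
  fixes x C :: real
  assumes "\<And>k :: nat. real k * x \<le> C"
  shows "x \<le> 0"
proof (rule ccontr)
  assume "\<not> x \<le> 0"
  then obtain k :: nat where "C < real k * x"
    using ex_less_of_nat_mult[of x C] by auto
  with assms[of k] show False by simp
qed

text \<open>Logarithms turn quasi-multiplicativity into additivity up to constants. Comparing
  \<open>n ^ k\<close> with the next power \<open>m ^ b\<close> shows that the growth rates of
  \<open>L\<close> measured along powers of \<open>n\<close> and of \<open>m\<close> agree, so one
  exponent \<open>s\<close> fits all \<open>n\<close>.\<close>

lemma quasi_multiplicative_power_growth:
  fixes L :: "nat \<Rightarrow> real"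
  assumes pos: "c > 0" "S > 0" "K > 0" "D > 0"
    and lower: "\<And>n. n \<ge> 1 \<Longrightarrow> c \<le> L n" and upper: "\<And>n. n \<ge> 1 \<Longrightarrow> L n \<le> S * real n"
    and mult_le: "\<And>n m. n \<ge> 1 \<Longrightarrow> m \<ge> 1 \<Longrightarrow> L (n * m) \<le> K * (L n * L m)"
    and le_mult: "\<And>n m. n \<ge> 1 \<Longrightarrow> m \<ge> 1 \<Longrightarrow> L n * L m \<le> K * L (n * m)"
    and mono: "\<And>n m. 1 \<le> n \<Longrightarrow> n \<le> m \<Longrightarrow> L n \<le> D * L m"
  obtains s A where "0 \<le> s" "s \<le> 1" "A > 0"
    "\<And>n. n \<ge> 1 \<Longrightarrow> real n powr s \<le> A * L n" "\<And>n. n \<ge> 1 \<Longrightarrow> L n \<le> A * real n powr s"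
proof -
  have Lpos: "L n > 0" if "n \<ge> 1" for n using lower[OF that] pos(1) by linarith
  define l where "l n = ln (L n)" for n
  \<comment> \<open>One constant dominating every additive error that arises below.\<close>
  define \<kappa> where "\<kappa> = \<bar>ln c\<bar> + \<bar>ln S\<bar> + \<bar>ln K\<bar> + \<bar>ln D\<bar>"
  have l_lower: "ln c \<le> l n" if "n \<ge> 1" for n
    using lower[OF that] pos(1) Lpos[OF that] by (simp add: l_def)
  have l_upper: "l n \<le> ln S + ln n" if "n \<ge> 1" for n
  proof -
    have "l n \<le> ln (S * real n)"
      unfolding l_def using upper[OF that] Lpos[OF that] pos(2) that by (subst ln_le_cancel_iff) auto
    also have "\<dots> = ln S + ln n" using pos(2) that by (intro ln_mult_pos) auto
    finally show ?thesis .
  qed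
  have l_mult: "l (n * m) \<le> ln K + l n + l m" "l n + l m \<le> ln K + l (n * m)"
    if nm: "n \<ge> 1" "m \<ge> 1" for n m
  proof -
    have nm1: "n * m \<ge> 1" using nm by simp
    note P = Lpos[OF nm(1)] Lpos[OF nm(2)] Lpos[OF nm1] pos(3)
    have "l (n * m) \<le> ln (K * (L n * L m))"
      unfolding l_def using mult_le[OF nm] P by (subst ln_le_cancel_iff) auto
    then show "l (n * m) \<le> ln K + l n + l m"
      using P by (simp add: ln_mult_pos l_def)
    have "ln (L n * L m) \<le> ln (K * L (n * m))"
      using le_mult[OF nm] P by (subst ln_le_cancel_iff) auto
    then show "l n + l m \<le> ln K + l (n * m)"
      using P by (simp add: ln_mult_pos l_def)
  qed
  have l_mono: "l n \<le> ln D + l m" if "1 \<le> n" "n \<le> m" for n m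
  proof -
    have "l n \<le> ln (D * L m)"
      unfolding l_def using mono[OF that] Lpos[of n] Lpos[of m] pos(4) that
      by (subst ln_le_cancel_iff) auto
    also have "\<dots> = ln D + l m" using pos(4) Lpos[of m] that by (simp add: ln_mult_pos l_def)
    finally show ?thesis .
  qed
  \<comment> \<open>The shift by \<open>\<kappa>\<close> absorbs \<open>ln K\<close>: along
    products, \<open>u\<close> is subadditive and \<open>w\<close> is superadditive.\<close>
  define u where "u n = l n + \<kappa>" for n
  define w where "w n = l n - \<kappa>" for n
  have u_nonneg: "u n \<ge> 0" if "n \<ge> 1" for n
    using l_lower[OF that] unfolding u_def \<kappa>_def by linarith
  have u_power: "u (m ^ b) \<le> real b * u m + u 1" if m: "m \<ge> 1" for m b
  proof (induction b)
    case (Suc b)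
    have "u (m * m ^ b) \<le> u m + u (m ^ b)"
      using l_mult(1)[OF m, of "m ^ b"] m unfolding u_def \<kappa>_def by simp
    with Suc show ?case by (simp add: algebra_simps)
  qed simp
  have w_power: "real k * w n + w 1 \<le> w (n ^ k)" if n: "n \<ge> 1" for n k
  proof (induction k)
    case (Suc k)
    have "w n + w (n ^ k) \<le> w (n * n ^ k)"
      using l_mult(2)[OF n, of "n ^ k"] n unfolding w_def \<kappa>_def by simp
    with Suc show ?case by (simp add: algebra_simps)
  qed simp
  have key: "w n \<le> u m / ln m * ln n" if n: "n \<ge> 2" and m: "m \<ge> 2" for n m
  proof -
    have lnm: "ln (real m) > 0" and lnn: "ln (real n) > 0" using n m by auto
    have "real k * (w n - u m / ln m * ln n) \<le> u m + u 1 - w 1" for k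
    proof -
      \<comment> \<open>The least \<open>b\<close> with \<open>n ^ k \<le> m ^ b\<close>. Rounding
        up costs at most one extra \<open>u m\<close>, which does not grow with \<open>k\<close> and
        disappears as \<open>k\<close> tends to infinity.\<close>
      define b where "b = nat \<lceil>real k * ln n / ln m\<rceil>"
      have q: "0 \<le> real k * ln n / ln m" using lnm lnn by simp
      then have b1: "real k * ln n / ln m \<le> real b" "real b \<le> real k * ln n / ln m + 1"
        unfolding b_def by linarith+
      have "ln (real (n ^ k)) \<le> ln (real (m ^ b))"
        using b1(1) lnm n m by (simp add: ln_realpow field_simps)
      then have "n ^ k \<le> m ^ b"
        using n m by (subst (asm) ln_le_cancel_iff) (auto simp flip: of_nat_power)
      then have "l (n ^ k) \<le> ln D + l (m ^ b)"
        using n by (intro l_mono) auto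
      then have "w (n ^ k) \<le> u (m ^ b)"
        unfolding w_def u_def \<kappa>_def by linarith
      then have "real k * w n + w 1 \<le> real b * u m + u 1"
        using w_power[of n k] u_power[of m b] n m by linarith
      moreover have "real b * u m \<le> (real k * ln n / ln m + 1) * u m"
        using b1(2) u_nonneg[of m] m by (intro mult_right_mono) auto
      ultimately show ?thesis by (simp add: algebra_simps)
    qed
    then have "w n - u m / ln m * ln n \<le> 0" by (rule nonpos_if_multiples_bounded)
    then show ?thesis by simp
  qed
  \<comment> \<open>By \<open>key\<close>, every quotient formed with \<open>w\<close> lies below
    every quotient formed with \<open>u\<close>, so this supremum separates the two
    families.\<close>
  define s where "s = (SUP n\<in>{2..}. w n / ln (real n))"
  have w_div: "w n / ln n \<le> u m / ln m" if "n \<ge> 2" "m \<ge> 2" for n m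
    using key[OF that] that by (simp add: pos_divide_le_eq)
  have bdd: "bdd_above ((\<lambda>n. w n / ln (real n)) ` {2..})"
    by (rule bdd_aboveI2[of _ _ "u 2 / ln 2"]) (use w_div[of _ 2] in auto)
  have s_ge: "w n \<le> s * ln n" if "n \<ge> 2" for n
  proof -
    have "w n / ln n \<le> s" unfolding s_def using that bdd by (intro cSUP_upper) auto
    then show ?thesis using that by (simp add: pos_divide_le_eq)
  qed
  have s_le: "s * ln m \<le> u m" if "m \<ge> 2" for m
  proof -
    have "s \<le> u m / ln m" unfolding s_def using that w_div by (intro cSUP_least) auto
    then show ?thesis using that by (simp add: pos_le_divide_eq)
  qed
  have "s \<le> 1"
    unfolding s_def
  proof (rule cSUP_least)
    fix n :: nat assume "n \<in> {2..}"
    then have n: "n \<ge> 2" by simp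
    have "w n \<le> ln n" using l_upper[of n] n unfolding w_def \<kappa>_def by linarith
    then show "w n / ln n \<le> 1" using n by simp
  qed auto
  \<comment> \<open>A negative exponent would force \<open>L (2 ^ k)\<close> to tend to 0, against
    the lower bound \<open>c\<close>.\<close>
  have "real k * (- s * ln 2) \<le> \<bar>ln c\<bar> + \<kappa>" for k
  proof (cases "k = 0")
    case False
    then have "2 \<le> (2 :: nat) ^ k" using power_increasing[of 1 k "2 :: nat"] by simp
    then have "w (2 ^ k) \<le> s * ln (real (2 ^ k))" by (rule s_ge)
    then have "w (2 ^ k) \<le> s * (real k * ln 2)" by (simp add: ln_realpow)
    moreover have "ln c - \<kappa> \<le> w (2 ^ k)" using l_lower[of "2 ^ k"] by (simp add: w_def)
    ultimately show ?thesis by (simp add: algebra_simps)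
  qed (simp add: \<kappa>_def)
  then have "- s * ln 2 \<le> 0" by (rule nonpos_if_multiples_bounded)
  then have "0 \<le> s" by (simp add: zero_le_mult_iff)
  \<comment> \<open>The case \<open>n = 1\<close> is separate because division by
    \<open>ln n\<close> excludes it.\<close>
  have est: "s * ln n \<le> \<kappa> + l n" "l n \<le> \<kappa> + s * ln n" if n: "n \<ge> 1" for n
  proof -
    consider "n = 1" | "n \<ge> 2" using n by linarith
    then have "s * ln n \<le> \<kappa> + l n \<and> l n \<le> \<kappa> + s * ln n"
    proof cases
      case 1
      have "ln c \<le> l 1" "l 1 \<le> ln S" using l_lower[of 1] l_upper[of 1] by simp_all
      then have "0 \<le> \<kappa> + l 1 \<and> l 1 \<le> \<kappa>" unfolding \<kappa>_def by linarith
      then show ?thesis using 1 by simp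
    next
      case 2
      then show ?thesis using s_ge[of n] s_le[of n] unfolding w_def u_def by linarith
    qed
    then show "s * ln n \<le> \<kappa> + l n" "l n \<le> \<kappa> + s * ln n" by auto
  qed
  have "real n powr s \<le> exp \<kappa> * L n" "L n \<le> exp \<kappa> * real n powr s" if n: "n \<ge> 1" for n
  proof -
    have e: "exp (l n) = L n" using Lpos[OF n] by (simp add: l_def)
    have p: "real n powr s = exp (s * ln n)" using n by (simp add: powr_def)
    have "exp (s * ln n) \<le> exp (\<kappa> + l n)" "exp (l n) \<le> exp (\<kappa> + s * ln n)"
      using est[OF n] by simp_all
    then show "real n powr s \<le> exp \<kappa> * L n" "L n \<le> exp \<kappa> * real n powr s"
      unfolding exp_add p e by simp_all
  qed
  with \<open>0 \<le> s\<close> \<open>s \<le> 1\<close> show ?thesis by (intro that[of s "exp \<kappa>"]) auto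
qed

text \<open>Lets estimates for powers lose constants and factors polynomial in \<open>k\<close>: for
  \<open>0 < b < a\<close> the ratio of \<open>a ^ k\<close> to \<open>b ^ k\<close> grows
  exponentially.\<close>

lemma le_if_powers_le_polynomial_mult:
  fixes a b M :: real
  assumes "a \<ge> 0" "b \<ge> 0" "M \<ge> 0"
    and le: "\<And>k. a ^ k \<le> M * real (k + 1) ^ d * b ^ k"
  shows "a \<le> b"
proof (rule ccontr)
  assume ab: "\<not> a \<le> b"
  show False
  proof (cases "b = 0")
    case True
    then show False using le[of 1] ab by simp
  next
    case False
    \<comment> \<open>Chosen so that \<open>(k + 1) ^ Suc d * (b / a) ^ k\<close> is the power
      \<open>Suc d\<close> of \<open>(k + 1) * r ^ k\<close>, which tends to 0. Raising the degree
      from \<open>d\<close> to \<open>Suc d\<close> keeps the root index positive.\<close>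
    define r where "r = root (Suc d) (b / a)"
    have a: "a > 0" and q: "0 < b / a" "b / a < 1" using False assms ab by auto
    have r: "0 < r" "r < 1" "r ^ Suc d = b / a"
      using q by (auto simp: r_def real_root_gt_zero real_root_pow_pos2 simp del: power_Suc)
    have lim1: "(\<lambda>k. real k * r ^ k) \<longlonglongrightarrow> 0"
      using powser_times_n_limit_0[of r] r by (simp del: power_Suc)
    have lim2: "(\<lambda>k. r ^ k) \<longlonglongrightarrow> 0" using LIMSEQ_realpow_zero[of r] r by simp
    have "(\<lambda>k. M * (real k * r ^ k + r ^ k) ^ Suc d) \<longlonglongrightarrow> M * (0 + 0) ^ Suc d"
      by (rule tendsto_mult[OF tendsto_const tendsto_power[OF tendsto_add[OF lim1 lim2]]])
    then have "(\<lambda>k. M * (real k * r ^ k + r ^ k) ^ Suc d) \<longlonglongrightarrow> 0" by simp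
    moreover have "1 \<le> M * (real k * r ^ k + r ^ k) ^ Suc d" for k
    proof -
      have "a ^ k \<le> M * real (k + 1) ^ d * b ^ k" by (rule le)
      also have "\<dots> \<le> M * real (k + 1) ^ Suc d * b ^ k"
        using assms by (intro mult_right_mono mult_left_mono power_increasing) auto
      finally have "1 \<le> M * real (k + 1) ^ Suc d * (b / a) ^ k"
        using a by (simp add: power_divide pos_le_divide_eq)
      also have "(b / a) ^ k = (r ^ k) ^ Suc d"
        using r(3) by (metis mult.commute power_mult)
      also have "M * real (k + 1) ^ Suc d * (r ^ k) ^ Suc d = M * (real k * r ^ k + r ^ k) ^ Suc d"
        by (simp only: mult.assoc flip: power_mult_distrib) (simp add: algebra_simps)
      finally show ?thesis .
    qed
    ultimately have "(1 :: real) \<le> 0" by (intro LIMSEQ_le_const) auto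
    then show False by simp
  qed
qed

section \<open>Coefficients of products\<close>

text \<open>The coefficients of \<alpha> \<otimes> \<beta> when \<open>a\<close> and
  \<open>b\<close> are those of \<alpha> and \<beta>, and \<open>m\<close> is the length of
  \<beta>.\<close>

definition tensor :: "nat \<Rightarrow> (nat \<Rightarrow> real) \<Rightarrow> (nat \<Rightarrow> real) \<Rightarrow> nat \<Rightarrow> real"
  where "tensor m a b = (\<lambda>l. a (l div m) * b (l mod m))"

lemma sum_div_mod:
  fixes F :: "nat \<Rightarrow> nat \<Rightarrow> 'b::comm_monoid_add"
  shows "(\<Sum>l<n * m. F (l div m) (l mod m)) = (\<Sum>i<n. \<Sum>j<m. F i j)"
proof -
  have "(\<Sum>l<n * m. F (l div m) (l mod m)) = (\<Sum>i<n. \<Sum>l=i*m..<i*m+m. F (l div m) (l mod m))"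
    by (rule sum.nat_group[symmetric])
  also have "\<dots> = (\<Sum>i<n. \<Sum>j<m. F i j)"
  proof (rule sum.cong[OF refl])
    fix i
    have "(\<Sum>l=i*m..<i*m+m. F (l div m) (l mod m)) = (\<Sum>j=0..<m. F ((j + i*m) div m) ((j + i*m) mod m))"
      using sum.shift_bounds_nat_ivl[of "\<lambda>l. F (l div m) (l mod m)" 0 "i*m" m] by (simp add: add.commute)
    also have "\<dots> = (\<Sum>j<m. F i j)"
      unfolding atLeast0LessThan by (rule sum.cong) auto
    finally show "(\<Sum>l=i*m..<i*m+m. F (l div m) (l mod m)) = (\<Sum>j<m. F i j)" .
  qed
  finally show ?thesis .
qed

lemma sum_tensor_scaleR:
  fixes g :: "nat \<Rightarrow> 'b::real_vector"
  shows "(\<Sum>l<n * m. tensor m a b l *\<^sub>R g l) = (\<Sum>i<n. a i *\<^sub>R (\<Sum>j<m. b j *\<^sub>R g (i * m + j)))"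
proof -
  have "(\<Sum>l<n * m. tensor m a b l *\<^sub>R g l)
      = (\<Sum>l<n * m. (a (l div m) * b (l mod m)) *\<^sub>R g (l div m * m + l mod m))"
    unfolding tensor_def div_mult_mod_eq ..
  also have "\<dots> = (\<Sum>i<n. \<Sum>j<m. (a i * b j) *\<^sub>R g (i * m + j))"
    by (rule sum_div_mod[of "\<lambda>i j. (a i * b j) *\<^sub>R g (i * m + j)"])
  finally show ?thesis by (simp add: scaleR_sum_right)
qed

lemma sum_tensor_powr:
  "(\<Sum>l<n * m. \<bar>tensor m a b l\<bar> powr p) = (\<Sum>i<n. \<bar>a i\<bar> powr p) * (\<Sum>j<m. \<bar>b j\<bar> powr p)"
  using sum_div_mod[where n = n and m = m and F = "\<lambda>i j. \<bar>a i\<bar> powr p * \<bar>b j\<bar> powr p"]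
  by (simp add: tensor_def abs_mult powr_mult sum_product)

text \<open>Here \<open>n\<close> is the length of \<open>x\<close>; the entries below
  \<open>n ^ k\<close> are the coefficients of the \<open>k\<close>-fold product, so for
  \<open>k = 0\<close> only index 0 counts.\<close>

primrec tensor_power :: "nat \<Rightarrow> (nat \<Rightarrow> real) \<Rightarrow> nat \<Rightarrow> nat \<Rightarrow> real"
  where
    "tensor_power n x 0 = (\<lambda>_. 1)"
  | "tensor_power n x (Suc k) = tensor (n ^ k) x (tensor_power n x k)"

text \<open>Quasi-multiplicativity asks for a nonzero last coefficient of the right factor; this
  formula keeps it nonzero under iteration.\<close>

lemma tensor_power_last:
  assumes "n > 0"
  shows "tensor_power n x k (n ^ k - 1) = x (n - 1) ^ k"
proof (induction k)
  case (Suc k)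
  have 1: "n * n ^ k - 1 = (n - 1) * n ^ k + (n ^ k - 1)"
  proof -
    obtain n' where "n = Suc n'" using assms gr0_implies_Suc by blast
    then show ?thesis by simp
  qed
  have 2: "n ^ k - 1 < n ^ k" using assms by simp
  have dm: "(q * N + r) div N = q \<and> (q * N + r) mod N = r" if "r < N" for q r N :: nat
    using that by simp
  have "(n * n ^ k - 1) div n ^ k = n - 1" "(n * n ^ k - 1) mod n ^ k = n ^ k - 1"
    unfolding 1 using dm[OF 2] by blast+
  then show ?case using Suc by (simp add: tensor_def)
qed simp

lemma sum_tensor_power_powr:
  "(\<Sum>j<n ^ k. \<bar>tensor_power n x k j\<bar> powr p) = (\<Sum>i<n. \<bar>x i\<bar> powr p) ^ k"
  by (induction k) (simp_all add: sum_tensor_powr)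

lemma tensor_power_monomial:
  assumes "j < n ^ k"
  shows "\<exists>E. (\<forall>i. E i \<le> k) \<and> tensor_power n x k j = (\<Prod>i<n. x i ^ E i)"
  using assms
proof (induction k arbitrary: j)
  case 0
  show ?case by (rule exI[of _ "\<lambda>_. 0"]) simp
next
  case (Suc k)
  have n: "n > 0" using Suc.prems by (cases n) auto
  define i where "i = j div n ^ k"
  have i: "i < n" unfolding i_def using Suc.prems by (intro less_mult_imp_div_less) simp
  obtain E where E: "\<forall>i. E i \<le> k" "tensor_power n x k (j mod n ^ k) = (\<Prod>i<n. x i ^ E i)"
    using Suc.IH[of "j mod n ^ k"] n by auto
  have "x i * (\<Prod>i<n. x i ^ E i) = (\<Prod>i'<n. x i' ^ (E(i := Suc (E i))) i')"
    using i by (simp add: prod.remove[of "{..<n}" i])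
  moreover have "(E(i := Suc (E i))) i' \<le> Suc k" for i' using E(1) by (simp add: le_SucI)
  ultimately show ?case
    using E(2) by (intro exI[of _ "E(i := Suc (E i))"]) (auto simp: tensor_def i_def[symmetric])
qed

text \<open>An entry is a product of \<open>k\<close> entries of \<open>x\<close> and depends only
  on how often each \<open>x i\<close> occurs, that is, on \<open>n\<close> exponents in
  \<open>{..k}\<close>. For fixed \<open>n\<close> their number is polynomial in
  \<open>k\<close>.\<close>

lemma card_tensor_power_values:
  "card (tensor_power n x k ` {..<n ^ k}) \<le> (k + 1) ^ n"
proof -
  have "tensor_power n x k ` {..<n ^ k} \<subseteq> (\<lambda>E. \<Prod>i<n. x i ^ E i) ` ({..<n} \<rightarrow>\<^sub>E {..k})"
  proof
    fix v assume "v \<in> tensor_power n x k ` {..<n ^ k}"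
    then obtain E where E: "\<forall>i. E i \<le> k" "v = (\<Prod>i<n. x i ^ E i)"
      using tensor_power_monomial[of _ n k x] by auto
    show "v \<in> (\<lambda>E. \<Prod>i<n. x i ^ E i) ` ({..<n} \<rightarrow>\<^sub>E {..k})"
      by (rule image_eqI[of _ _ "restrict E {..<n}"]) (use E in auto)
  qed
  then have "card (tensor_power n x k ` {..<n ^ k}) \<le> card ({..<n} \<rightarrow>\<^sub>E {..k})"
    by (rule surj_card_le[rotated]) (auto intro: finite_PiE)
  then show ?thesis by (simp add: card_PiE)
qed

section \<open>Independent sequences\<close>

text \<open>The product depends on the true length of its right factor, so expansions have to be
  freed of trailing zeros.\<close>

lemma trim_zeros:
  fixes a :: "nat \<Rightarrow> real"
  shows "\<exists>n'\<le>n. (n' > 0 \<longrightarrow> a (n' - 1) \<noteq> 0) \<and> (\<forall>i. n' \<le> i \<longrightarrow> i < n \<longrightarrow> a i = 0)"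
proof (induction n)
  case (Suc n)
  then show ?case
  proof (cases "a n = 0")
    case True
    with Suc show ?thesis by (metis le_SucI less_SucE)
  qed (auto intro!: exI[of _ "Suc n"])
qed simp

definition section_norm :: "(nat \<Rightarrow> 'a::real_normed_vector) \<Rightarrow> nat \<Rightarrow> (nat \<Rightarrow> real) \<Rightarrow> real"
  where "section_norm f n a = norm (\<Sum>i<n. a i *\<^sub>R f i)"

lemma section_norm_nonneg [simp]: "section_norm f n a \<ge> 0"
  by (simp add: section_norm_def)

lemma section_norm_tensor:
  "section_norm f (n * m) (tensor m a b) = norm (\<Sum>i<n. a i *\<^sub>R (\<Sum>j<m. b j *\<^sub>R f (i * m + j)))"
  unfolding section_norm_def sum_tensor_scaleR ..

text \<open>The estimate of (b) in terms of coefficients. The length of the right factor fixes the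
  block size, hence its nonzero last coefficient; trailing zeros of \<open>a\<close> merely add zero
  blocks.\<close>

definition quasi_multiplicative :: "(nat \<Rightarrow> 'a::real_normed_vector) \<Rightarrow> real \<Rightarrow> bool"
  where "quasi_multiplicative f K \<longleftrightarrow> (\<forall>n m a b. m > 0 \<longrightarrow> b (m - 1) \<noteq> 0 \<longrightarrow>
    section_norm f n a * section_norm f m b \<le> K * section_norm f (n * m) (tensor m a b) \<and>
    section_norm f (n * m) (tensor m a b) \<le> K * (section_norm f n a * section_norm f m b))"

text \<open>Independence and injectivity determine the coordinates with respect to \<open>f\<close>,
  and both pass to subsequences directly.\<close>

locale independent_sequence =
  fixes f :: "nat \<Rightarrow> 'a::real_normed_vector"
  assumes inj: "inj f" and independent: "independent (range f)"
begin

lemma coord_sum: "coord f (\<Sum>i<n. a i *\<^sub>R f i) k = (if k < n then a k else 0)"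
proof -
  have "coord f (\<Sum>i<n. a i *\<^sub>R f i) k = (\<Sum>i<n. a i * representation (range f) (f i) (f k))"
    unfolding coord_def
    by (subst representation_sum[OF independent])
      (auto simp: representation_scale[OF independent] span_base span_scale)
  also have "\<dots> = (\<Sum>i<n. if i = k then a i else 0)"
    by (intro sum.cong) (auto simp: representation_basis[OF independent] inj_eq[OF inj])
  finally show ?thesis by simp
qed

lemma supp_length_sum:
  assumes "n > 0 \<Longrightarrow> a (n - 1) \<noteq> 0"
  shows "supp_length f (\<Sum>i<n. a i *\<^sub>R f i) = n"
  unfolding supp_length_def coord_sum
proof (rule Least_equality)
  fix y assume y: "\<forall>i\<ge>y. (if i < n then a i else 0) = 0"
  show "n \<le> y"
  proof (rule ccontr)
    assume "\<not> n \<le> y"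
    then have "y \<le> n - 1" "n - 1 < n" "n > 0" by auto
    with y assms show False by (metis (full_types))
  qed
qed auto

lemma block_mult_sum:
  assumes a: "n > 0 \<Longrightarrow> a (n - 1) \<noteq> 0" and b: "m > 0 \<Longrightarrow> b (m - 1) \<noteq> 0"
  shows "block_mult f (\<Sum>i<n. a i *\<^sub>R f i) (\<Sum>j<m. b j *\<^sub>R f j) = (\<Sum>l<n * m. tensor m a b l *\<^sub>R f l)"
  unfolding block_mult_def supp_length_sum[of n a, OF a, simplified] supp_length_sum[of m b, OF b, simplified]
    sum_tensor_scaleR
  by (intro sum.cong refl arg_cong2[where f = scaleR]) (auto simp: coord_sum)

lemma span_expansion:
  assumes "\<alpha> \<in> span (range f)"
  shows "\<exists>n a. \<alpha> = (\<Sum>i<n. a i *\<^sub>R f i) \<and> (n > 0 \<longrightarrow> a (n - 1) \<noteq> 0)"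
proof -
  have "\<exists>n a. \<alpha> = (\<Sum>i<n. a i *\<^sub>R f i)"
    using assms
  proof (induction rule: span_induct_alt)
    case base
    show ?case by (rule exI[of _ 0]) simp
  next
    case (step c x y)
    then obtain i n a where i: "x = f i" and y: "y = (\<Sum>i<n. a i *\<^sub>R f i)" by auto
    let ?m = "max n (Suc i)"
    have "y = (\<Sum>j<?m. (if j < n then a j else 0) *\<^sub>R f j)"
      unfolding y by (rule sum.mono_neutral_cong_left) auto
    moreover have "c *\<^sub>R x = (\<Sum>j<?m. (if j = i then c else 0) *\<^sub>R f j)"
      using sum.delta[of "{..<?m}" i "\<lambda>j. c *\<^sub>R f j"]
      by (simp add: i if_distrib[where f = "\<lambda>t. t *\<^sub>R _"] less_max_iff_disj cong: if_cong)
    ultimately have "c *\<^sub>R x + y = (\<Sum>j<?m. ((if j = i then c else 0) + (if j < n then a j else 0)) *\<^sub>R f j)"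
      by (simp only: scaleR_add_left sum.distrib)
    then show ?case by (intro exI)
  qed
  then obtain n a where \<alpha>: "\<alpha> = (\<Sum>i<n. a i *\<^sub>R f i)" by blast
  obtain n' where n': "n' \<le> n" "n' > 0 \<longrightarrow> a (n' - 1) \<noteq> 0" "\<forall>i. n' \<le> i \<longrightarrow> i < n \<longrightarrow> a i = 0"
    using trim_zeros[of n a] by blast
  have "\<alpha> = (\<Sum>i<n'. a i *\<^sub>R f i)"
    unfolding \<alpha> using n' by (intro sum.mono_neutral_right) auto
  then show ?thesis using n'(2) by blast
qed

lemma quasi_multiplicative_iff:
  assumes "K > 0"
  shows "quasi_multiplicative f K \<longleftrightarrow>
    (\<forall>\<alpha>\<in>span (range f). \<forall>\<beta>\<in>span (range f).
      1 / K * (norm \<alpha> * norm \<beta>) \<le> norm (block_mult f \<alpha> \<beta>) \<and>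
      norm (block_mult f \<alpha> \<beta>) \<le> K * (norm \<alpha> * norm \<beta>))" (is "_ \<longleftrightarrow> ?R")
proof
  assume qm: "quasi_multiplicative f K"
  show ?R
  proof (intro ballI)
    fix \<alpha> \<beta> assume \<alpha>\<beta>: "\<alpha> \<in> span (range f)" "\<beta> \<in> span (range f)"
    obtain n a where \<alpha>: "\<alpha> = (\<Sum>i<n. a i *\<^sub>R f i)" "n > 0 \<longrightarrow> a (n - 1) \<noteq> 0"
      using span_expansion[OF \<alpha>\<beta>(1)] by blast
    obtain m b where \<beta>: "\<beta> = (\<Sum>i<m. b i *\<^sub>R f i)" "m > 0 \<longrightarrow> b (m - 1) \<noteq> 0"
      using span_expansion[OF \<alpha>\<beta>(2)] by blast
    show "1 / K * (norm \<alpha> * norm \<beta>) \<le> norm (block_mult f \<alpha> \<beta>) \<and>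
      norm (block_mult f \<alpha> \<beta>) \<le> K * (norm \<alpha> * norm \<beta>)"
    proof (cases "m = 0")
      case True
      then have "\<beta> = 0" using \<beta> by simp
      then show ?thesis by (simp add: block_mult_zero_right)
    next
      case False
      then have "m > 0" "b (m - 1) \<noteq> 0" using \<beta> by auto
      from qm[unfolded quasi_multiplicative_def, rule_format, of m b n a, OF this]
      have "norm \<alpha> * norm \<beta> \<le> K * norm (block_mult f \<alpha> \<beta>)"
        "norm (block_mult f \<alpha> \<beta>) \<le> K * (norm \<alpha> * norm \<beta>)"
        using block_mult_sum[of n a m b] \<alpha>(2) \<beta>(2) by (simp_all add: section_norm_def \<alpha>(1) \<beta>(1))
      then show ?thesis using assms by (simp add: pos_divide_le_eq mult.commute)
    qed
  qed
next
  assume R: ?R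
  show "quasi_multiplicative f K"
    unfolding quasi_multiplicative_def
  proof (intro allI impI)
    fix n m :: nat and a b :: "nat \<Rightarrow> real"
    assume b: "m > 0" "b (m - 1) \<noteq> 0"
    \<comment> \<open>The product formula needs the exact support length of the left factor too; the
      blocks cut off here are zero.\<close>
    obtain n' where n': "n' \<le> n" "n' > 0 \<longrightarrow> a (n' - 1) \<noteq> 0" "\<forall>i. n' \<le> i \<longrightarrow> i < n \<longrightarrow> a i = 0"
      using trim_zeros[of n a] by blast
    define \<alpha> where "\<alpha> = (\<Sum>i<n. a i *\<^sub>R f i)"
    define \<beta> where "\<beta> = (\<Sum>i<m. b i *\<^sub>R f i)"
    have \<alpha>: "\<alpha> = (\<Sum>i<n'. a i *\<^sub>R f i)"
      unfolding \<alpha>_def using n' by (intro sum.mono_neutral_right) auto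
    have "block_mult f \<alpha> \<beta> = (\<Sum>l<n' * m. tensor m a b l *\<^sub>R f l)"
      unfolding \<alpha> \<beta>_def using b n'(2) by (intro block_mult_sum) auto
    also have "\<dots> = (\<Sum>l<n * m. tensor m a b l *\<^sub>R f l)"
      unfolding sum_tensor_scaleR using n' by (intro sum.mono_neutral_left) auto
    finally have "norm (block_mult f \<alpha> \<beta>) = section_norm f (n * m) (tensor m a b)"
      by (simp add: section_norm_def)
    moreover have "\<alpha> \<in> span (range f)" "\<beta> \<in> span (range f)"
      unfolding \<alpha>_def \<beta>_def by (intro span_sum span_scale span_base rangeI)+
    ultimately have "1 / K * (norm \<alpha> * norm \<beta>) \<le> section_norm f (n * m) (tensor m a b) \<and>
        section_norm f (n * m) (tensor m a b) \<le> K * (norm \<alpha> * norm \<beta>)"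
      using R by metis
    then show "section_norm f n a * section_norm f m b \<le> K * section_norm f (n * m) (tensor m a b) \<and>
        section_norm f (n * m) (tensor m a b) \<le> K * (section_norm f n a * section_norm f m b)"
      using assms by (simp add: section_norm_def \<alpha>_def \<beta>_def pos_divide_le_eq mult.commute)
  qed
qed

end

lemma independent_subsequence:
  assumes "basic_sequence e" "strict_mono (r :: nat \<Rightarrow> nat)"
  shows "independent_sequence (e \<circ> r)"
proof
  show "inj (e \<circ> r)"
    using basic_sequence_inj[OF assms(1)] strict_mono_imp_inj_on[OF assms(2)] by (rule inj_compose)
  show "independent (range (e \<circ> r))"
    by (rule independent_mono[OF basic_sequence_independent[OF assms(1)]]) auto
qed

section \<open>Equivalence with the unit vector basis\<close>

definition truncate :: "nat \<Rightarrow> (nat \<Rightarrow> real) \<Rightarrow> nat \<Rightarrow> real"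
  where "truncate n a = (\<lambda>i. if i < n then a i else 0)"

lemma sum_fun_apply: "(\<Sum>i\<in>I. F i) k = (\<Sum>i\<in>I. F i k)"
  by (induction I rule: infinite_finite_induct) (auto simp: zero_fun_def plus_fun_def)

lemma sum_unit_vector:
  assumes "finite {i. a i \<noteq> 0}"
  shows "(\<Sum>i | a i \<noteq> 0. a i *\<^sub>R unit_vector i) = a"
proof
  fix k
  have "(\<Sum>i | a i \<noteq> 0. a i *\<^sub>R unit_vector i) k = (\<Sum>i | a i \<noteq> 0. if i = k then a i else 0)"
    unfolding sum_fun_apply by (rule sum.cong) (auto simp: scaleR_fun_def unit_vector_def)
  also have "\<dots> = a k" using assms by simp
  finally show "(\<Sum>i | a i \<noteq> 0. a i *\<^sub>R unit_vector i) k = a k" .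
qed

lemma equivalent_unit_vectors_iff:
  "equivalent_sequences norm f M unit_vector \<longleftrightarrow>
    (\<exists>C>0. \<forall>n a. section_norm f n a \<le> C * M (truncate n a) \<and> M (truncate n a) \<le> C * section_norm f n a)"
  (is "_ \<longleftrightarrow> ?R")
proof
  assume "equivalent_sequences norm f M unit_vector"
  then obtain C where C0: "C > 0" and eq: "\<forall>a. finite {i. a i \<noteq> 0} \<longrightarrow>
      1 / C * norm (\<Sum>i | a i \<noteq> 0. a i *\<^sub>R f i) \<le> M (\<Sum>i | a i \<noteq> 0. a i *\<^sub>R unit_vector i) \<and>
      M (\<Sum>i | a i \<noteq> 0. a i *\<^sub>R unit_vector i) \<le> C * norm (\<Sum>i | a i \<noteq> 0. a i *\<^sub>R f i)"
    unfolding equivalent_sequences_def by (elim exE conjE)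
  have "section_norm f n a \<le> C * M (truncate n a) \<and> M (truncate n a) \<le> C * section_norm f n a" for n a
  proof -
    have fin: "finite {i. truncate n a i \<noteq> 0}"
      by (rule finite_subset[of _ "{..<n}"]) (auto simp: truncate_def)
    have "(\<Sum>i | truncate n a i \<noteq> 0. truncate n a i *\<^sub>R f i) = (\<Sum>i<n. a i *\<^sub>R f i)"
      by (rule sum.mono_neutral_cong_left) (auto simp: truncate_def)
    then show ?thesis
      using eq[rule_format, OF fin] C0 unfolding sum_unit_vector[OF fin]
      by (simp add: section_norm_def pos_divide_le_eq mult.commute)
  qed
  then show ?R using C0 by blast
next
  assume ?R
  then obtain C where C: "C > 0" "\<And>n a. section_norm f n a \<le> C * M (truncate n a)"
    "\<And>n a. M (truncate n a) \<le> C * section_norm f n a" by blast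
  show "equivalent_sequences norm f M unit_vector"
    unfolding equivalent_sequences_def
  proof (intro exI[of _ C] conjI C(1) allI impI)
    fix a :: "nat \<Rightarrow> real" assume fin: "finite {i. a i \<noteq> 0}"
    then obtain n where n: "\<forall>i\<in>{i. a i \<noteq> 0}. i < n"
      using finite_nat_set_iff_bounded by blast
    have "truncate n a = a" using n by (auto simp: truncate_def fun_eq_iff)
    moreover have "section_norm f n a = norm (\<Sum>i | a i \<noteq> 0. a i *\<^sub>R f i)"
      unfolding section_norm_def using n by (intro arg_cong[of _ _ norm] sum.mono_neutral_right) auto
    ultimately show "1 / C * norm (\<Sum>i | a i \<noteq> 0. a i *\<^sub>R f i) \<le> M (\<Sum>i | a i \<noteq> 0. a i *\<^sub>R unit_vector i)"
      "M (\<Sum>i | a i \<noteq> 0. a i *\<^sub>R unit_vector i) \<le> C * norm (\<Sum>i | a i \<noteq> 0. a i *\<^sub>R f i)"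
      using C(1) C(2)[of n a] C(3)[of n a] unfolding sum_unit_vector[OF fin]
      by (simp_all add: pos_divide_le_eq mult.commute)
  qed
qed

text \<open>Tensor powers give estimates for vectors with nonzero last coefficient; trimming
  trailing zeros changes neither norm and so reaches all vectors.\<close>

lemma equivalent_if_section_bounds:
  assumes B: "B > 0" "B' > 0"
    and le: "\<And>n x. n > 0 \<Longrightarrow> x (n - 1) \<noteq> 0 \<Longrightarrow> section_norm f n x \<le> B * M (truncate n x)"
    and ge: "\<And>n x. n > 0 \<Longrightarrow> x (n - 1) \<noteq> 0 \<Longrightarrow> M (truncate n x) \<le> B' * section_norm f n x"
    and zero: "M (\<lambda>_. 0) = 0" and nonneg: "\<And>n x. M (truncate n x) \<ge> 0"
  shows "equivalent_sequences norm f M unit_vector"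
  unfolding equivalent_unit_vectors_iff
proof (intro exI[of _ "max B B'"] conjI allI)
  show "max B B' > 0" using B by simp
  fix n and a :: "nat \<Rightarrow> real"
  obtain n' where n': "n' \<le> n" "n' > 0 \<longrightarrow> a (n' - 1) \<noteq> 0" "\<forall>i. n' \<le> i \<longrightarrow> i < n \<longrightarrow> a i = 0"
    using trim_zeros[of n a] by blast
  have 1: "section_norm f n a = section_norm f n' a"
    unfolding section_norm_def using n' by (intro arg_cong[of _ _ norm] sum.mono_neutral_right) auto
  have 2: "truncate n a = truncate n' a"
    using n' by (auto simp: truncate_def fun_eq_iff)
  have "section_norm f n' a \<le> B * M (truncate n' a) \<and> M (truncate n' a) \<le> B' * section_norm f n' a"
  proof (cases "n' = 0")
    case True
    then show ?thesis using zero by (simp add: section_norm_def truncate_def)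
  next
    case False
    then show ?thesis using n'(2) le ge by simp
  qed
  then show "section_norm f n a \<le> max B B' * M (truncate n a)" "M (truncate n a) \<le> max B B' * section_norm f n a"
    unfolding 1 2 using nonneg[of n' a] section_norm_nonneg[of f n' a]
    by (meson max.cobounded1 max.cobounded2 mult_right_mono order_trans)+
qed

section \<open>Exact multiplicativity of the norms of ell_p and c_0\<close>

lemma lp_norm_truncate: "lp_norm p (truncate n a) = (\<Sum>i<n. \<bar>a i\<bar> powr p) powr (1 / p)"
proof -
  have "(\<Sum>k. \<bar>truncate n a k\<bar> powr p) = (\<Sum>i<n. \<bar>truncate n a i\<bar> powr p)"
    by (rule suminf_finite) (auto simp: truncate_def)
  then show ?thesis by (simp add: lp_norm_def truncate_def)
qed

lemma lp_norm_tensor: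
  "lp_norm p (truncate (n * m) (tensor m a b)) = lp_norm p (truncate n a) * lp_norm p (truncate m b)"
  unfolding lp_norm_truncate sum_tensor_powr by (simp add: powr_mult sum_nonneg)

lemma finite_range_truncate: "finite (range (\<lambda>i. \<bar>truncate n a i\<bar>))"
  by (rule finite_subset[of _ "insert 0 ((\<lambda>i. \<bar>a i\<bar>) ` {..<n})"]) (auto simp: truncate_def)

lemma abs_le_c0_norm:
  assumes "i < n"
  shows "\<bar>a i\<bar> \<le> c0_norm (truncate n a)"
proof -
  have "\<bar>truncate n a i\<bar> \<le> c0_norm (truncate n a)"
    unfolding c0_norm_def by (rule cSUP_upper) (auto simp: finite_range_truncate intro: bdd_above_finite)
  then show ?thesis using assms by (simp add: truncate_def)
qed

lemma c0_norm_le: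
  assumes "B \<ge> 0" "\<And>i. i < n \<Longrightarrow> \<bar>a i\<bar> \<le> B"
  shows "c0_norm (truncate n a) \<le> B"
  unfolding c0_norm_def by (rule cSUP_least) (use assms in \<open>auto simp: truncate_def\<close>)

lemma c0_norm_nonneg: "c0_norm (truncate n a) \<ge> 0"
  unfolding c0_norm_def
  by (rule cSUP_upper2[of "\<lambda>k. \<bar>truncate n a k\<bar>" _ n])
    (auto simp: finite_range_truncate intro: bdd_above_finite)

lemma c0_norm_tensor:
  "c0_norm (truncate (n * m) (tensor m a b)) = c0_norm (truncate n a) * c0_norm (truncate m b)"
proof (rule antisym)
  show "c0_norm (truncate (n * m) (tensor m a b)) \<le> c0_norm (truncate n a) * c0_norm (truncate m b)"
  proof (rule c0_norm_le)
    fix l assume l: "l < n * m"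
    then have "l div m < n" "l mod m < m"
      by (simp_all add: less_mult_imp_div_less) (metis mod_less_divisor mult_0_right not_gr0 not_less0)
    then show "\<bar>tensor m a b l\<bar> \<le> c0_norm (truncate n a) * c0_norm (truncate m b)"
      unfolding tensor_def abs_mult by (intro mult_mono abs_le_c0_norm c0_norm_nonneg) auto
  qed (simp add: c0_norm_nonneg)
  \<comment> \<open>The supremum runs over finitely many values and is a maximum; if it is taken at
    an index outside \<open>{..<n}\<close>, it is 0.\<close>
  have attained: "c0_norm (truncate n a) = 0 \<or> (\<exists>i<n. \<bar>a i\<bar> = c0_norm (truncate n a))" for n a
  proof -
    have "c0_norm (truncate n a) \<in> range (\<lambda>i. \<bar>truncate n a i\<bar>)"
      unfolding c0_norm_def by (subst cSup_eq_Max) (auto simp: finite_range_truncate intro: Max_in)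
    then show ?thesis by (auto simp: truncate_def split: if_splits)
  qed
  show "c0_norm (truncate n a) * c0_norm (truncate m b) \<le> c0_norm (truncate (n * m) (tensor m a b))"
  proof (cases "c0_norm (truncate n a) = 0 \<or> c0_norm (truncate m b) = 0")
    case True
    then show ?thesis by (auto simp: c0_norm_nonneg)
  next
    case False
    with attained[of n a] attained[of m b] obtain i j where ij: "i < n" "j < m"
      "\<bar>a i\<bar> = c0_norm (truncate n a)" "\<bar>b j\<bar> = c0_norm (truncate m b)" by auto
    have "i * m + j < n * m"
    proof -
      have "i * m + j < (i + 1) * m" using ij(2) by simp
      also have "\<dots> \<le> n * m" using ij(1) by (intro mult_right_mono) auto
      finally show ?thesis .
    qed
    then have "\<bar>tensor m a b (i * m + j)\<bar> \<le> c0_norm (truncate (n * m) (tensor m a b))"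
      by (rule abs_le_c0_norm)
    then show ?thesis using ij by (simp add: tensor_def abs_mult)
  qed
qed

lemma quasi_multiplicative_if_equivalent:
  assumes eq: "equivalent_sequences norm f M unit_vector"
    and nonneg: "\<And>n a. M (truncate n a) \<ge> 0"
    and mult: "\<And>n m a b. M (truncate (n * m) (tensor m a b)) = M (truncate n a) * M (truncate m b)"
  obtains K where "K > 0" "quasi_multiplicative f K"
proof -
  obtain C where C: "C > 0" "\<And>n a. section_norm f n a \<le> C * M (truncate n a)"
    "\<And>n a. M (truncate n a) \<le> C * section_norm f n a"
    using eq unfolding equivalent_unit_vectors_iff by blast
  \<comment> \<open>Three norms are exchanged, each at the cost of one factor
    \<open>C\<close>.\<close>
  have "quasi_multiplicative f (C * C * C)"
    unfolding quasi_multiplicative_def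
  proof (intro allI impI conjI)
    fix n m a b
    have "section_norm f n a * section_norm f m b \<le> (C * M (truncate n a)) * (C * M (truncate m b))"
      using C nonneg by (intro mult_mono) (auto intro!: mult_nonneg_nonneg less_imp_le)
    also have "\<dots> = C * C * M (truncate (n * m) (tensor m a b))" by (simp add: mult)
    also have "\<dots> \<le> C * C * (C * section_norm f (n * m) (tensor m a b))"
      using C by (intro mult_left_mono) auto
    finally show "section_norm f n a * section_norm f m b \<le> C * C * C * section_norm f (n * m) (tensor m a b)"
      by (simp add: mult.assoc)
    have "section_norm f (n * m) (tensor m a b) \<le> C * (M (truncate n a) * M (truncate m b))"
      using C(2)[of "n * m" "tensor m a b"] by (simp add: mult)
    also have "\<dots> \<le> C * ((C * section_norm f n a) * (C * section_norm f m b))"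
      using C nonneg by (intro mult_left_mono mult_mono) (auto intro!: mult_nonneg_nonneg less_imp_le)
    finally show "section_norm f (n * m) (tensor m a b) \<le> C * C * C * (section_norm f n a * section_norm f m b)"
      by (simp add: mult_ac)
  qed
  with C(1) show ?thesis by (intro that[of "C * C * C"]) auto
qed

section \<open>Spreading and unconditionality\<close>

locale quasi_multiplicative_sequence = independent_sequence +
  fixes K c S :: real
  assumes K_pos: "K > 0" and c_pos: "c > 0"
    and norm_ge: "\<And>i. c \<le> norm (f i)" and norm_le: "\<And>i. norm (f i) \<le> S"
    and quasi_mult: "quasi_multiplicative f K"
    and stable: "spread_stable f"
begin

lemma S_pos: "S > 0"
  using c_pos norm_ge[of 0] norm_le[of 0] by linarith

lemma section_norm_tensor_ge:
  "m > 0 \<Longrightarrow> b (m - 1) \<noteq> 0 \<Longrightarrow>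
    section_norm f n a * section_norm f m b \<le> K * section_norm f (n * m) (tensor m a b)"
  using quasi_mult unfolding quasi_multiplicative_def by blast

lemma section_norm_tensor_le:
  "m > 0 \<Longrightarrow> b (m - 1) \<noteq> 0 \<Longrightarrow>
    section_norm f (n * m) (tensor m a b) \<le> K * (section_norm f n a * section_norm f m b)"
  using quasi_mult unfolding quasi_multiplicative_def by blast

text \<open>The right factor is the single vector \<open>f (m - 1)\<close>, of support length
  \<open>m\<close> and norm between \<open>c\<close> and \<open>S\<close>, so the product moves
  index \<open>i\<close> to \<open>i * m + (m - 1)\<close>.\<close>

lemma norm_sum_progression:
  assumes "finite I" "m > 0"
  shows "norm (\<Sum>i\<in>I. a i *\<^sub>R f i) * c \<le> K * norm (\<Sum>i\<in>I. a i *\<^sub>R f (i * m + (m - 1)))"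
    and "norm (\<Sum>i\<in>I. a i *\<^sub>R f (i * m + (m - 1))) \<le> K * S * norm (\<Sum>i\<in>I. a i *\<^sub>R f i)"
proof -
  define b :: "nat \<Rightarrow> real" where "b j = (if j = m - 1 then 1 else 0)" for j
  define a' where "a' i = (if i \<in> I then a i else 0)" for i
  obtain n where n: "I \<subseteq> {..<n}" using assms(1) finite_nat_iff_bounded by blast
  have restrict: "(\<Sum>i<n. a' i *\<^sub>R g i) = (\<Sum>i\<in>I. a i *\<^sub>R g i)" for g :: "nat \<Rightarrow> 'a"
    using n by (intro sum.mono_neutral_cong_right) (auto simp: a'_def)
  have b_sum: "(\<Sum>j<m. b j *\<^sub>R g j) = g (m - 1)" for g :: "nat \<Rightarrow> 'a"
  proof -
    have "(\<Sum>j<m. b j *\<^sub>R g j) = (\<Sum>j<m. if j = m - 1 then g j else 0)"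
      by (rule sum.cong) (auto simp: b_def)
    then show ?thesis using assms(2) by simp
  qed
  have sn: "section_norm f n a' = norm (\<Sum>i\<in>I. a i *\<^sub>R f i)" "section_norm f m b = norm (f (m - 1))"
    "section_norm f (n * m) (tensor m a' b) = norm (\<Sum>i\<in>I. a i *\<^sub>R f (i * m + (m - 1)))"
    unfolding section_norm_tensor unfolding section_norm_def
    by (simp_all add: restrict b_sum del: add_diff_assoc)
  have b: "b (m - 1) \<noteq> 0" by (simp add: b_def)
  have "norm (\<Sum>i\<in>I. a i *\<^sub>R f i) * c \<le> norm (\<Sum>i\<in>I. a i *\<^sub>R f i) * norm (f (m - 1))"
    by (intro mult_left_mono norm_ge) simp
  also have "\<dots> \<le> K * norm (\<Sum>i\<in>I. a i *\<^sub>R f (i * m + (m - 1)))"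
    using section_norm_tensor_ge[of m b n a', OF assms(2) b] by (simp only: sn)
  finally show "norm (\<Sum>i\<in>I. a i *\<^sub>R f i) * c \<le> K * norm (\<Sum>i\<in>I. a i *\<^sub>R f (i * m + (m - 1)))" .
  have "norm (\<Sum>i\<in>I. a i *\<^sub>R f (i * m + (m - 1))) \<le> K * (norm (\<Sum>i\<in>I. a i *\<^sub>R f i) * norm (f (m - 1)))"
    using section_norm_tensor_le[of m b n a', OF assms(2) b] by (simp only: sn)
  also have "\<dots> \<le> K * (norm (\<Sum>i\<in>I. a i *\<^sub>R f i) * S)"
    using K_pos by (intro mult_left_mono norm_le) auto
  finally show "norm (\<Sum>i\<in>I. a i *\<^sub>R f (i * m + (m - 1))) \<le> K * S * norm (\<Sum>i\<in>I. a i *\<^sub>R f i)"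
    by (simp add: mult_ac)
qed

lemma norm_sum_progression_subsequence:
  fixes a :: "nat \<Rightarrow> real" and n :: "nat \<Rightarrow> nat"
  assumes "strict_mono_on {..<k} n" "m > 0"
  shows "norm (\<Sum>i<k. a i *\<^sub>R f (n i)) * c \<le> K * norm (\<Sum>i<k. a i *\<^sub>R f (n i * m + (m - 1)))"
    and "norm (\<Sum>i<k. a i *\<^sub>R f (n i * m + (m - 1))) \<le> K * S * norm (\<Sum>i<k. a i *\<^sub>R f (n i))"
proof -
  \<comment> \<open>Carries the coefficients over to the range of \<open>n\<close>, so that the
    estimate for finite index sets applies.\<close>
  define a' where "a' l = a (the_inv_into {..<k} n l)" for l
  have inj: "inj_on n {..<k}" using assms(1) by (rule strict_mono_on_imp_inj_on)
  have reindex: "(\<Sum>l\<in>n ` {..<k}. a' l *\<^sub>R g l) = (\<Sum>i<k. a i *\<^sub>R g (n i))" for g :: "nat \<Rightarrow> 'a"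
    by (simp add: sum.reindex[OF inj] a'_def the_inv_into_f_f[OF inj])
  show "norm (\<Sum>i<k. a i *\<^sub>R f (n i)) * c \<le> K * norm (\<Sum>i<k. a i *\<^sub>R f (n i * m + (m - 1)))"
    using norm_sum_progression(1)[of "n ` {..<k}" m a'] assms(2)
      reindex[of f] reindex[of "\<lambda>l. f (l * m + (m - 1))"] by simp
  show "norm (\<Sum>i<k. a i *\<^sub>R f (n i * m + (m - 1))) \<le> K * S * norm (\<Sum>i<k. a i *\<^sub>R f (n i))"
    using norm_sum_progression(2)[of "n ` {..<k}" m a'] assms(2)
      reindex[of f] reindex[of "\<lambda>l. f (l * m + (m - 1))"] by simp
qed

text \<open>A factor \<open>K / c\<close> is lost on moving a sum out to a progression, and
  \<open>K * S\<close> on moving it back.\<close>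

definition C where "C = K * (K * S) / c"

lemma C_pos: "C > 0"
  unfolding C_def using K_pos S_pos c_pos by simp

text \<open>A progression with large step carries both sums so far out that stability makes their
  norms almost equal. Moving out and back costs \<open>C\<close>, and the error
  \<open>\<delta>\<close> is arbitrary.\<close>

lemma spreading:
  fixes a :: "nat \<Rightarrow> real" and n n' :: "nat \<Rightarrow> nat"
  assumes n: "strict_mono_on {..<k} n" and n': "strict_mono_on {..<k} n'"
  shows "norm (\<Sum>i<k. a i *\<^sub>R f (n i)) \<le> C * norm (\<Sum>i<k. a i *\<^sub>R f (n' i))"
proof -
  have "norm (\<Sum>i<k. a i *\<^sub>R f (n i)) * c \<le> K * (K * S * norm (\<Sum>i<k. a i *\<^sub>R f (n' i))) + \<delta>"
    if "\<delta> > 0" for \<delta>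
  proof -
    have "\<delta> / K > 0" using that K_pos by simp
    then obtain M where M: "\<forall>n n'. strict_mono_on {..<k} n \<longrightarrow> strict_mono_on {..<k} n' \<longrightarrow>
      (\<forall>i<k. M \<le> n i \<and> M \<le> n' i) \<longrightarrow>
      \<bar>norm (\<Sum>i<k. a i *\<^sub>R f (n i)) - norm (\<Sum>i<k. a i *\<^sub>R f (n' i))\<bar> < \<delta> / K"
      using stable unfolding spread_stable_def by presburger
    \<comment> \<open>With this step every index \<open>i * m + (m - 1)\<close> is at least
      \<open>M\<close>.\<close>
    define m where "m = Suc M"
    have mono: "strict_mono (\<lambda>l. l * m + (m - 1))"
      by (auto simp: strict_mono_def m_def intro!: add_less_le_mono mult_strict_right_mono)
    have large: "\<forall>i<k. M \<le> n i * m + (m - 1) \<and> M \<le> n' i * m + (m - 1)"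
      by (auto simp: m_def)
    have close: "norm (\<Sum>i<k. a i *\<^sub>R f (n i * m + (m - 1)))
        \<le> norm (\<Sum>i<k. a i *\<^sub>R f (n' i * m + (m - 1))) + \<delta> / K"
      using M[rule_format, OF strict_mono_on_compose[OF n mono] strict_mono_on_compose[OF n' mono]] large
      by fastforce
    have "norm (\<Sum>i<k. a i *\<^sub>R f (n i)) * c \<le> K * norm (\<Sum>i<k. a i *\<^sub>R f (n i * m + (m - 1)))"
      using n by (rule norm_sum_progression_subsequence) (simp add: m_def)
    also have "\<dots> \<le> K * (K * S * norm (\<Sum>i<k. a i *\<^sub>R f (n' i)) + \<delta> / K)"
      using close norm_sum_progression_subsequence(2)[OF n', of m a] K_pos
      by (intro mult_left_mono) (auto simp: m_def)
    also have "\<dots> = K * (K * S * norm (\<Sum>i<k. a i *\<^sub>R f (n' i))) + \<delta>"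
      using K_pos by (simp add: distrib_left)
    finally show ?thesis .
  qed
  then have "norm (\<Sum>i<k. a i *\<^sub>R f (n i)) * c \<le> K * (K * S * norm (\<Sum>i<k. a i *\<^sub>R f (n' i)))"
    by (rule field_le_epsilon)
  then show ?thesis using c_pos by (simp add: C_def field_simps)
qed

section \<open>Unconditionality through sequences of differences\<close>

abbreviation (input) alternating :: "nat \<Rightarrow> real"
  where "alternating j \<equiv> if j = 0 then 1 else - 1"

lemma sum_tensor_alternating:
  fixes g :: "nat \<Rightarrow> 'a"
  shows "(\<Sum>l<k * 2. tensor 2 a alternating l *\<^sub>R g l) = (\<Sum>i<k. a i *\<^sub>R (g (i * 2) - g (i * 2 + 1)))"
  unfolding sum_tensor_scaleR by (simp add: numeral_2_eq_2)

lemma spreading_differences: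
  fixes a :: "nat \<Rightarrow> real" and n n' :: "nat \<Rightarrow> nat"
  assumes "strict_mono n" "strict_mono n'"
  shows "norm (\<Sum>i<k. a i *\<^sub>R (f (n (i * 2)) - f (n (i * 2 + 1))))
    \<le> C * norm (\<Sum>i<k. a i *\<^sub>R (f (n' (i * 2)) - f (n' (i * 2 + 1))))"
  using spreading[where k = "k * 2" and n = n and n' = n' and a = "tensor 2 a alternating"] assms
    sum_tensor_alternating[where k = k and a = a and g = "\<lambda>i. f (n i)"]
    sum_tensor_alternating[where k = k and a = a and g = "\<lambda>i. f (n' i)"]
  by (auto simp: strict_mono_on_def strict_mono_def)

text \<open>Puts the ends of the \<open>i\<close>-th difference at positions \<open>p i\<close> and
  \<open>q i\<close> of the \<open>i\<close>-th block of length \<open>N + 1\<close>. The order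
  inside a block comes from \<open>p i < q i\<close>, between blocks from
  \<open>q i \<le> N\<close>.\<close>

lemma block_index_strict_mono:
  fixes p q :: "nat \<Rightarrow> nat"
  assumes "\<And>i. p i < q i" "\<And>i. q i \<le> N"
  shows "strict_mono (\<lambda>l. (l div 2) * (N + 1) + (if even l then p (l div 2) else q (l div 2)))"
proof (rule strict_monoI_Suc)
  fix l
  show "(l div 2) * (N + 1) + (if even l then p (l div 2) else q (l div 2))
      < (Suc l div 2) * (N + 1) + (if even (Suc l) then p (Suc l div 2) else q (Suc l div 2))"
  proof (cases "even l")
    case True
    then show ?thesis using assms(1)[of "l div 2"] by simp
  next
    case False
    then have "Suc l div 2 = Suc (l div 2)" by simp
    then show ?thesis using False assms(2)[of "l div 2"] by (simp add: le_imp_less_Suc trans_less_add1)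
  qed
qed

text \<open>Slide each removed difference along a fresh block of length \<open>N + 1\<close>: the average over all
  positions telescopes to a term of order \<open>1 / N\<close>, while every position costs only the
  spreading constant.\<close>

lemma differences_suppression_unconditional:
  fixes a :: "nat \<Rightarrow> real"
  shows "norm (\<Sum>i<k. (if i \<in> A then a i else 0) *\<^sub>R (f (i * 2) - f (i * 2 + 1)))
    \<le> C * C * norm (\<Sum>i<k. a i *\<^sub>R (f (i * 2) - f (i * 2 + 1)))"
proof -
  define X where "X = norm (\<Sum>i<k. (if i \<in> A then a i else 0) *\<^sub>R (f (i * 2) - f (i * 2 + 1)))"
  define Y where "Y = norm (\<Sum>i<k. a i *\<^sub>R (f (i * 2) - f (i * 2 + 1)))"
  define Q where "Q = (\<Sum>i<k. \<bar>a i\<bar> * (S + S))"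
  have Q0: "Q \<ge> 0" unfolding Q_def using S_pos by (intro sum_nonneg) auto
  have "real N * (X - C * C * Y) \<le> C * Q" for N
  proof (cases "N = 0")
    case True
    then show ?thesis using Q0 C_pos by simp
  next
    case False
    define h where "h i r = f (i * (N + 1) + r)" for i r
    define W where "W = (\<Sum>i<k. (if i \<in> A then a i else 0) *\<^sub>R (h i 0 - h i N))"
    \<comment> \<open>\<open>V t\<close> stretches the differences in \<open>A\<close> over their
      whole blocks and places the others at position \<open>t\<close>. Summing over \<open>t\<close>
      gives \<open>N\<close> copies of \<open>W\<close> and one telescoped remainder.\<close>
    define V where "V t = (\<Sum>i<k. a i *\<^sub>R (if i \<in> A then h i 0 - h i N else h i t - h i (Suc t)))" for t
    have id: "strict_mono (\<lambda>l :: nat. l)" by (simp add: strict_mono_def)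
    have V: "norm (V t) \<le> C * Y" if "t < N" for t
    proof -
      define n where "n l = (l div 2) * (N + 1) + (if even l then (if l div 2 \<in> A then 0 else t)
          else (if l div 2 \<in> A then N else Suc t))" for l
      have "strict_mono n"
        unfolding n_def
        by (rule block_index_strict_mono[of "\<lambda>i. if i \<in> A then 0 else t" "\<lambda>i. if i \<in> A then N else Suc t" N])
          (use that False in auto)
      from spreading_differences[OF this id, where k = k and a = a]
      have "norm (\<Sum>i<k. a i *\<^sub>R (f (n (i * 2)) - f (n (i * 2 + 1)))) \<le> C * Y"
        by (simp add: Y_def)
      also have "(\<Sum>i<k. a i *\<^sub>R (f (n (i * 2)) - f (n (i * 2 + 1)))) = V t"
        unfolding V_def h_def n_def by (intro sum.cong) auto
      finally show ?thesis .
    qed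
    have W: "X \<le> C * norm W"
    proof -
      define n where "n l = (l div 2) * (N + 1) + (if even l then 0 else N)" for l
      have "strict_mono n"
        unfolding n_def using block_index_strict_mono[of "\<lambda>_. 0" "\<lambda>_. N" N] False by simp
      from spreading_differences[OF id this, where k = k and a = "\<lambda>i. if i \<in> A then a i else 0"]
      have "X \<le> C * norm (\<Sum>i<k. (if i \<in> A then a i else 0) *\<^sub>R (f (n (i * 2)) - f (n (i * 2 + 1))))"
        by (simp add: X_def)
      also have "(\<Sum>i<k. (if i \<in> A then a i else 0) *\<^sub>R (f (n (i * 2)) - f (n (i * 2 + 1)))) = W"
        unfolding W_def h_def n_def by (intro sum.cong) auto
      finally show ?thesis .
    qed
    \<comment> \<open>The telescoped remainder; its norm is at most \<open>Q\<close>, independently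
      of \<open>N\<close>.\<close>
    define R where "R = (\<Sum>i<k. (if i \<in> A then 0 else a i) *\<^sub>R (h i 0 - h i N))"
    have "(\<Sum>t<N. V t) = (\<Sum>i<k. a i *\<^sub>R (\<Sum>t<N. if i \<in> A then h i 0 - h i N else h i t - h i (Suc t)))"
      unfolding V_def scaleR_sum_right by (rule sum.swap)
    also have "\<dots> = (\<Sum>i<k. real N *\<^sub>R ((if i \<in> A then a i else 0) *\<^sub>R (h i 0 - h i N)) +
        (if i \<in> A then 0 else a i) *\<^sub>R (h i 0 - h i N))"
    proof (rule sum.cong[OF refl])
      fix i
      have "(\<Sum>t<N. h i t - h i (Suc t)) = h i 0 - h i N" by (rule sum_lessThan_telescope')
      then show "a i *\<^sub>R (\<Sum>t<N. if i \<in> A then h i 0 - h i N else h i t - h i (Suc t)) =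
          real N *\<^sub>R ((if i \<in> A then a i else 0) *\<^sub>R (h i 0 - h i N)) +
          (if i \<in> A then 0 else a i) *\<^sub>R (h i 0 - h i N)"
        by (simp add: sum_constant_scaleR)
    qed
    also have "\<dots> = real N *\<^sub>R W + R"
      unfolding W_def R_def by (simp add: sum.distrib scaleR_sum_right)
    finally have VW: "real N *\<^sub>R W = (\<Sum>t<N. V t) - R" by simp
    have "norm R \<le> Q"
      unfolding R_def Q_def
    proof (rule sum_norm_le)
      fix i
      have "norm (h i 0 - h i N) \<le> S + S"
        unfolding h_def by (rule order_trans[OF norm_triangle_ineq4 add_mono[OF norm_le norm_le]])
      then show "norm ((if i \<in> A then 0 else a i) *\<^sub>R (h i 0 - h i N)) \<le> \<bar>a i\<bar> * (S + S)"
        using S_pos by (auto intro: mult_left_mono)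
    qed
    moreover have "norm (\<Sum>t<N. V t) \<le> real N * (C * Y)"
      using sum_norm_le[of "{..<N}" V "\<lambda>_. C * Y"] V by simp
    ultimately have "real N * norm W \<le> real N * (C * Y) + Q"
      using norm_triangle_ineq4[of "\<Sum>t<N. V t" R] arg_cong[OF VW, of norm] by simp
    then have "C * (real N * norm W) \<le> C * (real N * (C * Y) + Q)"
      using C_pos by (intro mult_left_mono) auto
    moreover have "real N * X \<le> real N * (C * norm W)" using W by (intro mult_left_mono) auto
    ultimately show ?thesis by (simp add: algebra_simps)
  qed
  then have "X - C * C * Y \<le> 0" by (rule nonpos_if_multiples_bounded)
  then show ?thesis by (simp add: X_def Y_def)
qed

text \<open>One \<open>K\<close> for passing from \<open>f\<close> to its differences,
  \<open>C * C\<close> for suppression there, and one \<open>K\<close> for returning.\<close>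

definition D where "D = K * (C * C * K)"

lemma D_pos: "D > 0"
  unfolding D_def using K_pos C_pos by simp

text \<open>Multiplying by \<open>f 0 - f 1\<close> replaces \<open>f\<close> by consecutive
  differences, where suppression is known. The common factor \<open>\<delta>\<close>, positive by
  injectivity, then cancels.\<close>

lemma suppression_unconditional:
  "section_norm f k (\<lambda>i. if i \<in> A then a i else 0) \<le> D * section_norm f k a"
proof -
  define \<delta> where "\<delta> = section_norm f 2 alternating"
  define a' where "a' i = (if i \<in> A then a i else 0)" for i
  have "\<delta> = norm (f 0 - f 1)"
    unfolding \<delta>_def section_norm_def by (simp add: numeral_2_eq_2)
  moreover have "f 0 \<noteq> f 1" using inj_eq[OF inj, of 0 1] by simp
  ultimately have "\<delta> > 0" by simp
  have diff: "section_norm f (k * 2) (tensor 2 b alternating) =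
      norm (\<Sum>i<k. b i *\<^sub>R (f (i * 2) - f (i * 2 + 1)))" for b
    unfolding section_norm_def sum_tensor_alternating ..
  have "section_norm f k a' * \<delta> \<le> K * section_norm f (k * 2) (tensor 2 a' alternating)"
    unfolding \<delta>_def by (rule section_norm_tensor_ge) auto
  also have "\<dots> \<le> K * (C * C * section_norm f (k * 2) (tensor 2 a alternating))"
    unfolding diff a'_def
    using K_pos by (intro mult_left_mono differences_suppression_unconditional) auto
  also have "\<dots> \<le> K * (C * C * (K * (section_norm f k a * \<delta>)))"
    unfolding \<delta>_def using K_pos C_pos by (intro mult_left_mono section_norm_tensor_le) auto
  finally have "section_norm f k a' * \<delta> \<le> (D * section_norm f k a) * \<delta>"
    by (simp add: D_def mult_ac)
  then have "section_norm f k a' \<le> D * section_norm f k a" using \<open>\<delta> > 0\<close> by simp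
  then show ?thesis unfolding a'_def .
qed

section \<open>Tensor powers\<close>

lemma norm_sum_eq_initial_section:
  assumes "finite L"
  shows "norm (\<Sum>i\<in>L. f i) \<le> C * section_norm f (card L) (\<lambda>_. 1)"
    and "section_norm f (card L) (\<lambda>_. 1) \<le> C * norm (\<Sum>i\<in>L. f i)"
proof -
  obtain h where h: "bij_betw h {..<card L} L" "strict_mono_on {..<card L} h"
    using ex_bij_betw_strict_mono_card[OF assms] by blast
  have id: "strict_mono_on {..<card L} (\<lambda>i. i)" by (simp add: strict_mono_on_def)
  have L: "(\<Sum>i\<in>L. f i) = (\<Sum>i<card L. 1 *\<^sub>R f (h i))"
    using sum.reindex_bij_betw[OF h(1), of f] by simp
  show "norm (\<Sum>i\<in>L. f i) \<le> C * section_norm f (card L) (\<lambda>_. 1)"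
    unfolding L section_norm_def by (rule spreading[OF h(2) id])
  show "section_norm f (card L) (\<lambda>_. 1) \<le> C * norm (\<Sum>i\<in>L. f i)"
    unfolding L section_norm_def by (rule spreading[OF id h(2)])
qed

text \<open>The tensor product of constant sequences 1 is again constant 1, so \<open>L\<close> is
  quasi-multiplicative; suppression makes it increasing up to \<open>D\<close>. This settles initial
  sections, and spreading transfers the growth to all finite sets.\<close>

lemma norm_sum_power_growth:
  "\<exists>s A. 0 \<le> s \<and> s \<le> 1 \<and> A > 0 \<and> (\<forall>L. finite L \<longrightarrow> L \<noteq> {} \<longrightarrow>
    real (card L) powr s \<le> A * norm (\<Sum>i\<in>L. f i) \<and> norm (\<Sum>i\<in>L. f i) \<le> A * real (card L) powr s)"
proof -
  define L where "L n = section_norm f n (\<lambda>_. 1)" for n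
  have restrict: "section_norm f k (\<lambda>i. if i < n then 1 else 0) = L n" if "n \<le> k" for n k
    unfolding L_def section_norm_def using that
    by (intro arg_cong[of _ _ norm] sum.mono_neutral_cong_right) auto
  have mono: "L n \<le> D * L m" if "n \<le> m" for n m
    using suppression_unconditional[of m "{..<n}" "\<lambda>_. 1"] restrict[OF that] by (simp add: L_def)
  have lower: "c / D \<le> L n" if "n \<ge> 1" for n
  proof -
    have "c \<le> L 1" using norm_ge[of 0] by (simp add: L_def section_norm_def)
    also have "\<dots> \<le> D * L n" using that by (rule mono)
    finally show ?thesis using D_pos by (simp add: pos_divide_le_eq mult.commute)
  qed
  have upper: "L n \<le> S * real n" for n
    using norm_sum_scaleR_le[where g = f and S = S and a = "\<lambda>_. 1" and I = "{..<n}" and n = "\<lambda>i. i", OF norm_le]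
    by (simp add: L_def section_norm_def mult.commute)
  have tensor_one: "tensor m (\<lambda>_. 1) (\<lambda>_. 1) = (\<lambda>_. 1)" for m by (simp add: tensor_def)
  obtain s A where sA: "0 \<le> s" "s \<le> 1" "A > 0"
    and lo: "\<And>n. n \<ge> 1 \<Longrightarrow> real n powr s \<le> A * L n"
    and up: "\<And>n. n \<ge> 1 \<Longrightarrow> L n \<le> A * real n powr s"
  proof (rule quasi_multiplicative_power_growth[of "c / D" S K D L])
    fix n m :: nat assume "m \<ge> 1"
    then show "L (n * m) \<le> K * (L n * L m)" "L n * L m \<le> K * L (n * m)"
      using section_norm_tensor_le[of m "\<lambda>_. 1" n "\<lambda>_. 1"] section_norm_tensor_ge[of m "\<lambda>_. 1" n "\<lambda>_. 1"]
      by (simp_all add: tensor_one L_def)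
  qed (use K_pos S_pos D_pos c_pos lower upper mono in auto)
  show ?thesis
  proof (rule exI[of _ s], rule exI[of _ "A * C"], intro conjI allI impI sA)
    show "A * C > 0" using sA C_pos by simp
    fix I :: "nat set" assume I: "finite I" "I \<noteq> {}"
    then have card: "card I \<ge> 1" by (simp add: Suc_le_eq card_gt_0_iff)
    have "real (card I) powr s \<le> A * L (card I)" by (rule lo[OF card])
    also have "\<dots> \<le> A * (C * norm (\<Sum>i\<in>I. f i))"
      unfolding L_def using sA by (intro mult_left_mono norm_sum_eq_initial_section I) auto
    finally show "real (card I) powr s \<le> A * C * norm (\<Sum>i\<in>I. f i)" by (simp add: mult.assoc)
    have "norm (\<Sum>i\<in>I. f i) \<le> C * L (card I)"
      unfolding L_def by (rule norm_sum_eq_initial_section[OF I(1)])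
    also have "\<dots> \<le> C * (A * real (card I) powr s)"
      using C_pos by (intro mult_left_mono up card) auto
    finally show "norm (\<Sum>i\<in>I. f i) \<le> A * C * real (card I) powr s" by (simp add: mult_ac)
  qed
qed

text \<open>Iterates quasi-multiplicativity. The zeroth power is the vector \<open>f 0\<close>,
  whose norm supplies \<open>c\<close> and \<open>S\<close>.\<close>

lemma section_norm_tensor_power:
  assumes n: "n > 0" and x: "x (n - 1) \<noteq> 0"
  shows "section_norm f n x ^ k * c \<le> K ^ k * section_norm f (n ^ k) (tensor_power n x k)"
    and "section_norm f (n ^ k) (tensor_power n x k) \<le> K ^ k * (section_norm f n x ^ k * S)"
proof (induction k)
  case 0
  show "section_norm f n x ^ 0 * c \<le> K ^ 0 * section_norm f (n ^ 0) (tensor_power n x 0)"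
    "section_norm f (n ^ 0) (tensor_power n x 0) \<le> K ^ 0 * (section_norm f n x ^ 0 * S)"
    using norm_ge[of 0] norm_le[of 0] by (simp_all add: section_norm_def)
next
  case (Suc k)
  have nz: "n ^ k > 0" "tensor_power n x k (n ^ k - 1) \<noteq> 0"
    using n x tensor_power_last[OF n, of x k] by auto
  have "section_norm f n x ^ Suc k * c \<le> section_norm f n x * (K ^ k * section_norm f (n ^ k) (tensor_power n x k))"
    using Suc(1) by (simp add: mult.assoc mult_left_mono)
  also have "\<dots> \<le> K ^ k * (K * section_norm f (n * n ^ k) (tensor (n ^ k) x (tensor_power n x k)))"
    using section_norm_tensor_ge[of "n ^ k" "tensor_power n x k" n x, OF nz] K_pos
    by (simp add: mult.left_commute)
  finally show "section_norm f n x ^ Suc k * c \<le> K ^ Suc k * section_norm f (n ^ Suc k) (tensor_power n x (Suc k))"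
    by (simp add: mult_ac)
  have "section_norm f (n ^ Suc k) (tensor_power n x (Suc k))
      \<le> K * (section_norm f n x * section_norm f (n ^ k) (tensor_power n x k))"
    using section_norm_tensor_le[of "n ^ k" "tensor_power n x k" n x, OF nz] by simp
  also have "\<dots> \<le> K * (section_norm f n x * (K ^ k * (section_norm f n x ^ k * S)))"
    using Suc(2) K_pos by (intro mult_left_mono) auto
  finally show "section_norm f (n ^ Suc k) (tensor_power n x (Suc k)) \<le> K ^ Suc k * (section_norm f n x ^ Suc k * S)"
    by (simp add: mult_ac)
qed

section \<open>Level sets of tensor powers and comparison with ell_p and c_0\<close>

abbreviation level :: "nat \<Rightarrow> (nat \<Rightarrow> real) \<Rightarrow> nat \<Rightarrow> real \<Rightarrow> nat set"
  where "level n x k v \<equiv> {j \<in> {..<n ^ k}. tensor_power n x k j = v}"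

text \<open>Splitting into level sets and using the triangle inequality costs only the number of
  levels, at most \<open>(k + 1) ^ n\<close>.\<close>

lemma section_norm_le_levels:
  assumes A: "A > 0" "\<And>L. finite L \<Longrightarrow> L \<noteq> {} \<Longrightarrow> norm (\<Sum>i\<in>L. f i) \<le> A * real (card L) powr s"
    and R: "R \<ge> 0"
      "\<And>v. v \<in> tensor_power n x k ` {..<n ^ k} \<Longrightarrow> \<bar>v\<bar> * real (card (level n x k v)) powr s \<le> R"
  shows "section_norm f (n ^ k) (tensor_power n x k) \<le> real (k + 1) ^ n * (A * R)"
proof -
  let ?T = "tensor_power n x k"
  have "(\<Sum>j<n ^ k. ?T j *\<^sub>R f j) = (\<Sum>v\<in>?T ` {..<n ^ k}. \<Sum>j\<in>level n x k v. ?T j *\<^sub>R f j)"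
    by (rule sum.image_gen) simp
  also have "\<dots> = (\<Sum>v\<in>?T ` {..<n ^ k}. v *\<^sub>R (\<Sum>j\<in>level n x k v. f j))"
    unfolding scaleR_sum_right by (intro sum.cong) auto
  finally have "section_norm f (n ^ k) ?T = norm (\<Sum>v\<in>?T ` {..<n ^ k}. v *\<^sub>R (\<Sum>j\<in>level n x k v. f j))"
    by (simp add: section_norm_def)
  also have "\<dots> \<le> (\<Sum>v\<in>?T ` {..<n ^ k}. A * R)"
  proof (rule sum_norm_le)
    fix v assume v: "v \<in> ?T ` {..<n ^ k}"
    have "norm (v *\<^sub>R (\<Sum>j\<in>level n x k v. f j)) \<le> \<bar>v\<bar> * (A * real (card (level n x k v)) powr s)"
      unfolding norm_scaleR using v by (intro mult_left_mono A(2)) auto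
    also have "\<dots> \<le> A * R"
      using mult_left_mono[OF R(2)[OF v], of A] A(1) by (simp add: mult_ac)
    finally show "norm (v *\<^sub>R (\<Sum>j\<in>level n x k v. f j)) \<le> A * R" .
  qed
  also have "\<dots> = real (card (?T ` {..<n ^ k})) * (A * R)" by simp
  also have "\<dots> \<le> real ((k + 1) ^ n) * (A * R)"
    using A(1) R(1) of_nat_mono[OF card_tensor_power_values[of n x k]] by (intro mult_right_mono) auto
  finally show ?thesis by simp
qed

text \<open>Suppressing all coordinates outside one level set costs \<open>D\<close> and leaves a
  multiple of a plain sum of the \<open>f i\<close>.\<close>

lemma level_le_section_norm:
  assumes A: "A > 0" "\<And>L. finite L \<Longrightarrow> L \<noteq> {} \<Longrightarrow> real (card L) powr s \<le> A * norm (\<Sum>i\<in>L. f i)"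
    and v: "v \<in> tensor_power n x k ` {..<n ^ k}"
  shows "\<bar>v\<bar> * real (card (level n x k v)) powr s \<le> A * D * section_norm f (n ^ k) (tensor_power n x k)"
proof -
  let ?T = "tensor_power n x k" and ?L = "level n x k v"
  have "\<bar>v\<bar> * real (card ?L) powr s \<le> \<bar>v\<bar> * (A * norm (\<Sum>j\<in>?L. f j))"
    using v by (intro mult_left_mono A(2)) auto
  also have "\<dots> = A * norm (v *\<^sub>R (\<Sum>j\<in>?L. f j))" by simp
  also have "v *\<^sub>R (\<Sum>j\<in>?L. f j) = (\<Sum>j<n ^ k. (if j \<in> ?L then ?T j else 0) *\<^sub>R f j)"
    unfolding scaleR_sum_right by (rule sum.mono_neutral_cong_left) auto
  also have "norm \<dots> = section_norm f (n ^ k) (\<lambda>j. if j \<in> ?L then ?T j else 0)"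
    by (simp add: section_norm_def)
  also have "A * \<dots> \<le> A * (D * section_norm f (n ^ k) ?T)"
    using A(1) by (intro mult_left_mono suppression_unconditional) auto
  finally show ?thesis by (simp add: mult.assoc)
qed

text \<open>Taking \<open>k\<close>-th roots removes \<open>A / c\<close> and the polynomial factor;
  one \<open>K\<close> per tensor factor survives.\<close>

lemma section_norm_le_if_levels:
  assumes n: "n > 0" and x: "x (n - 1) \<noteq> 0" and q: "q \<ge> 0"
    and A: "A > 0" "\<And>L. finite L \<Longrightarrow> L \<noteq> {} \<Longrightarrow> norm (\<Sum>i\<in>L. f i) \<le> A * real (card L) powr s"
    and R: "\<And>k v. v \<in> tensor_power n x k ` {..<n ^ k} \<Longrightarrow> \<bar>v\<bar> * real (card (level n x k v)) powr s \<le> q ^ k"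
  shows "section_norm f n x \<le> K * q"
proof (rule le_if_powers_le_polynomial_mult)
  show "section_norm f n x ^ k \<le> A / c * real (k + 1) ^ n * (K * q) ^ k" for k
  proof -
    have "section_norm f n x ^ k * c \<le> K ^ k * section_norm f (n ^ k) (tensor_power n x k)"
      by (rule section_norm_tensor_power[where x = x, OF n x])
    also have "\<dots> \<le> K ^ k * (real (k + 1) ^ n * (A * q ^ k))"
      using section_norm_le_levels[where s = s and R = "q ^ k", OF A _ R] K_pos q
      by (intro mult_left_mono) auto
    finally show ?thesis using c_pos by (simp add: pos_le_divide_eq power_mult_distrib mult_ac)
  qed
qed (use K_pos q A c_pos in auto)

text \<open>The contributions of the level sets to the sum of \<open>p\<close>-th powers add up to
  \<open>\<sigma> ^ k\<close>. Each is at most this total, which gives the upper bound; the largest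
  is at least the total divided by \<open>(k + 1) ^ n\<close>, which gives the lower one.\<close>

lemma equivalent_lp:
  assumes s: "0 < s" "s \<le> 1" and A: "A > 0"
    and up: "\<And>L. finite L \<Longrightarrow> L \<noteq> {} \<Longrightarrow> norm (\<Sum>i\<in>L. f i) \<le> A * real (card L) powr s"
    and lo: "\<And>L. finite L \<Longrightarrow> L \<noteq> {} \<Longrightarrow> real (card L) powr s \<le> A * norm (\<Sum>i\<in>L. f i)"
    and n: "n > 0" and x: "x (n - 1) \<noteq> 0"
  shows "section_norm f n x \<le> K * lp_norm (1 / s) (truncate n x)"
    and "lp_norm (1 / s) (truncate n x) \<le> K * section_norm f n x"
proof -
  define p where "p = 1 / s"
  have p: "p > 0" "s * p = 1" using s by (auto simp: p_def)
  define \<sigma> where "\<sigma> = (\<Sum>i<n. \<bar>x i\<bar> powr p)"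
  have \<sigma>: "\<sigma> \<ge> 0" unfolding \<sigma>_def by (intro sum_nonneg) auto
  have q: "lp_norm (1 / s) (truncate n x) = \<sigma> powr s"
    using s by (simp add: lp_norm_truncate \<sigma>_def p_def)
  let ?T = "tensor_power n x" and ?V = "\<lambda>k. tensor_power n x k ` {..<n ^ k}"
  \<comment> \<open>As \<open>s * p = 1\<close>, the weight of a level set is the
    \<open>s\<close>-th power of its contribution to the sum of \<open>p\<close>-th powers.\<close>
  have level: "\<bar>v\<bar> * real (card (level n x k v)) powr s = (\<bar>v\<bar> powr p * real (card (level n x k v))) powr s" for k v
    using p by (simp add: powr_mult powr_powr mult.commute)
  have sum_levels: "(\<Sum>v\<in>?V k. \<bar>v\<bar> powr p * real (card (level n x k v))) = \<sigma> ^ k" for k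
  proof -
    have "\<sigma> ^ k = (\<Sum>j<n ^ k. \<bar>?T k j\<bar> powr p)" unfolding \<sigma>_def by (rule sum_tensor_power_powr[symmetric])
    also have "\<dots> = (\<Sum>v\<in>?V k. \<Sum>j\<in>level n x k v. \<bar>?T k j\<bar> powr p)" by (rule sum.image_gen) simp
    also have "\<dots> = (\<Sum>v\<in>?V k. \<bar>v\<bar> powr p * real (card (level n x k v)))"
      by (intro sum.cong) (auto simp: mult.commute)
    finally show ?thesis by simp
  qed
  have powr_power_s: "(\<sigma> ^ k) powr s = (\<sigma> powr s) ^ k" for k
    using \<sigma> by (induction k) (simp_all add: powr_mult)
  show "section_norm f n x \<le> K * lp_norm (1 / s) (truncate n x)"
    unfolding q
  proof (rule section_norm_le_if_levels[where x = x, OF n x _ A up])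
    fix k v assume v: "v \<in> ?V k"
    have "\<bar>v\<bar> powr p * real (card (level n x k v)) \<le> \<sigma> ^ k"
      unfolding sum_levels[symmetric] using v by (intro member_le_sum) auto
    then have "(\<bar>v\<bar> powr p * real (card (level n x k v))) powr s \<le> (\<sigma> ^ k) powr s"
      using s by (intro powr_mono2) auto
    then show "\<bar>v\<bar> * real (card (level n x k v)) powr s \<le> (\<sigma> powr s) ^ k"
      unfolding level powr_power_s .
  qed auto
  show "lp_norm (1 / s) (truncate n x) \<le> K * section_norm f n x"
    unfolding q
  proof (rule le_if_powers_le_polynomial_mult)
    show "(\<sigma> powr s) ^ k \<le> (A * D * S) * real (k + 1) ^ n * (K * section_norm f n x) ^ k" for k
    proof -
      define P where "P = real (k + 1) ^ n"
      have P: "P \<ge> 1" unfolding P_def by simp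
      have V: "finite (?V k)" "?V k \<noteq> {}" using n by (auto simp: lessThan_empty_iff)
      obtain v where v: "v \<in> ?V k" "\<sigma> ^ k \<le> P * (\<bar>v\<bar> powr p * real (card (level n x k v)))"
      proof -
        define t where "t v = \<bar>v\<bar> powr p * real (card (level n x k v))" for v
        obtain v where v: "v \<in> ?V k" "\<And>w. w \<in> ?V k \<Longrightarrow> t w \<le> t v"
          using obtains_MAX[OF V, of t] Max_ge[of "t ` ?V k"] V(1) by (metis finite_imageI image_eqI)
        have "\<sigma> ^ k \<le> real (card (?V k)) * t v"
          using sum_bounded_above[of "?V k" t "t v"] v(2) sum_levels[of k] by (simp add: t_def)
        also have "\<dots> \<le> real ((k + 1) ^ n) * t v"
          using of_nat_mono[OF card_tensor_power_values[of n x k]] by (intro mult_right_mono) (auto simp: t_def)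
        finally show ?thesis using that v(1) by (simp add: t_def P_def)
      qed
      have "(\<sigma> powr s) ^ k \<le> (P * (\<bar>v\<bar> powr p * real (card (level n x k v)))) powr s"
        unfolding powr_power_s[symmetric] using v(2) s \<sigma> by (intro powr_mono2) auto
      also have "\<dots> = P powr s * (\<bar>v\<bar> * real (card (level n x k v)) powr s)"
        unfolding level using P by (simp add: powr_mult)
      also have "\<dots> \<le> P * (A * D * (K ^ k * (section_norm f n x ^ k * S)))"
      proof (rule mult_mono)
        \<comment> \<open>Since \<open>P \<ge> 1\<close> and \<open>s \<le> 1\<close>, the power
          \<open>s\<close> does not increase \<open>P\<close>, and the polynomial degree stays
          \<open>n\<close>.\<close>
        show "P powr s \<le> P" using P s powr_mono[of s 1 P] by simp
        have "\<bar>v\<bar> * real (card (level n x k v)) powr s \<le> A * D * section_norm f (n ^ k) (?T k)"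
          by (rule level_le_section_norm[OF A lo v(1)])
        also have "\<dots> \<le> A * D * (K ^ k * (section_norm f n x ^ k * S))"
          using A D_pos by (intro mult_left_mono section_norm_tensor_power[where x = x, OF n x]) auto
        finally show "\<bar>v\<bar> * real (card (level n x k v)) powr s \<le> A * D * (K ^ k * (section_norm f n x ^ k * S))" .
      qed (use P in auto)
      finally show ?thesis by (simp add: P_def power_mult_distrib mult_ac)
    qed
  qed (use K_pos A D_pos S_pos in auto)
qed

text \<open>The case of exponent 0, where a level set weighs at most \<open>\<bar>v\<bar>\<close>.
  The lower bound is direct: suppression down to one coordinate leaves a vector of norm at least
  \<open>\<bar>x i\<bar> * c\<close>.\<close>

lemma equivalent_c0:
  assumes A: "A > 0"
    and up: "\<And>L. finite L \<Longrightarrow> L \<noteq> {} \<Longrightarrow> norm (\<Sum>i\<in>L. f i) \<le> A"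
    and n: "n > 0" and x: "x (n - 1) \<noteq> 0"
  shows "section_norm f n x \<le> K * c0_norm (truncate n x)"
    and "c0_norm (truncate n x) \<le> D / c * section_norm f n x"
proof -
  let ?q = "c0_norm (truncate n x)"
  show "section_norm f n x \<le> K * ?q"
  proof (rule section_norm_le_if_levels[where x = x, OF n x c0_norm_nonneg A, where s = 0])
    fix L :: "nat set" assume "finite L" "L \<noteq> {}"
    then show "norm (\<Sum>i\<in>L. f i) \<le> A * real (card L) powr 0" using up by simp
  next
    fix k v assume v: "v \<in> tensor_power n x k ` {..<n ^ k}"
    have "\<bar>tensor_power n x k j\<bar> \<le> ?q ^ k" if "j < n ^ k" for j
      using that
    proof (induction k arbitrary: j)
      case (Suc k)
      have "j div n ^ k < n" "j mod n ^ k < n ^ k"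
        using Suc.prems n by (auto intro: less_mult_imp_div_less)
      then show ?case
        using Suc.IH by (auto simp: tensor_def abs_mult intro!: mult_mono abs_le_c0_norm c0_norm_nonneg)
    qed simp
    \<comment> \<open>The factor with \<open>powr 0\<close> is 1, or 0 at base 0, so it never
      exceeds 1.\<close>
    with v show "\<bar>v\<bar> * real (card (level n x k v)) powr 0 \<le> ?q ^ k"
      by (auto simp: powr_def)
  qed
  show "?q \<le> D / c * section_norm f n x"
  proof (rule c0_norm_le)
    fix i assume i: "i < n"
    have "\<bar>x i\<bar> * c \<le> \<bar>x i\<bar> * norm (f i)" by (intro mult_left_mono norm_ge) simp
    also have "\<dots> = section_norm f n (\<lambda>j. if j \<in> {i} then x j else 0)"
      unfolding section_norm_def using i
      by (subst sum.mono_neutral_cong_right[of "{..<n}" "{i}" _ "\<lambda>j. x j *\<^sub>R f j"]) auto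
    also have "\<dots> \<le> D * section_norm f n x" by (rule suppression_unconditional)
    finally show "\<bar>x i\<bar> \<le> D / c * section_norm f n x" using c_pos by (simp add: pos_le_divide_eq)
  qed (use D_pos c_pos in simp)
qed

lemma equivalent_c0_or_lp:
  "equivalent_sequences norm f c0_norm unit_vector \<or>
    (\<exists>p\<ge>1. equivalent_sequences norm f (lp_norm p) unit_vector)"
proof -
  obtain s A where s: "0 \<le> s" "s \<le> 1" and A: "A > 0"
    and lo: "\<And>L. finite L \<Longrightarrow> L \<noteq> {} \<Longrightarrow> real (card L) powr s \<le> A * norm (\<Sum>i\<in>L. f i)"
    and up: "\<And>L. finite L \<Longrightarrow> L \<noteq> {} \<Longrightarrow> norm (\<Sum>i\<in>L. f i) \<le> A * real (card L) powr s"
    using norm_sum_power_growth by blast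
  show ?thesis
  \<comment> \<open>Exponent 0 means bounded sums and leads to c_0; otherwise
    \<open>p = 1 / s\<close>, and \<open>s \<le> 1\<close> becomes \<open>p \<ge> 1\<close>.\<close>
  proof (cases "s = 0")
    case True
    then have "norm (\<Sum>i\<in>L. f i) \<le> A" if "finite L" "L \<noteq> {}" for L
      using up[OF that] that by simp
    note c0 = equivalent_c0[OF A this]
    have "equivalent_sequences norm f c0_norm unit_vector"
      by (rule equivalent_if_section_bounds[OF K_pos _ c0])
        (use D_pos c_pos c0_norm_nonneg in \<open>auto simp: c0_norm_def\<close>)
    then show ?thesis ..
  next
    case False
    then have "0 < s" using s by simp
    note lp = equivalent_lp[OF this s(2) A up lo]
    have "equivalent_sequences norm f (lp_norm (1 / s)) unit_vector"
      by (rule equivalent_if_section_bounds[OF K_pos K_pos lp]) (auto simp: lp_norm_def)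
    moreover have "1 / s \<ge> 1" using \<open>0 < s\<close> s(2) by simp
    ultimately show ?thesis by blast
  qed
qed

end

section \<open>The equivalence of (a) and (b)\<close>

theorem theorem16:
  fixes e :: "nat \<Rightarrow> 'a::banach"
  assumes "basic_sequence e" and "semi_normalized e"
  shows "(\<forall>r :: nat \<Rightarrow> nat. strict_mono r \<longrightarrow>
      (\<exists>s :: nat \<Rightarrow> nat. strict_mono s \<and>
        (equivalent_sequences norm (e \<circ> r \<circ> s) c0_norm unit_vector \<or>
         (\<exists>p\<ge>1. equivalent_sequences norm (e \<circ> r \<circ> s) (lp_norm p) unit_vector))))
    \<longleftrightarrow>
    (\<forall>r :: nat \<Rightarrow> nat. strict_mono r \<longrightarrow>
      (\<exists>s :: nat \<Rightarrow> nat. strict_mono s \<and>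
        (let f = e \<circ> r \<circ> s in
          \<exists>K>0. \<forall>\<alpha>\<in>span (range f). \<forall>\<beta>\<in>span (range f).
            1 / K * (norm \<alpha> * norm \<beta>) \<le> norm (block_mult f \<alpha> \<beta>) \<and>
            norm (block_mult f \<alpha> \<beta>) \<le> K * (norm \<alpha> * norm \<beta>))))" (is "?a \<longleftrightarrow> ?b")
proof -
  have sub: "independent_sequence (e \<circ> r \<circ> s)" if "strict_mono r" "strict_mono s" for r s :: "nat \<Rightarrow> nat"
    using independent_subsequence[OF assms(1) strict_mono_o[OF that]] by (simp add: comp_assoc)
  have b_iff: "(let f = e \<circ> r \<circ> s in
      \<exists>K>0. \<forall>\<alpha>\<in>span (range f). \<forall>\<beta>\<in>span (range f).
        1 / K * (norm \<alpha> * norm \<beta>) \<le> norm (block_mult f \<alpha> \<beta>) \<and>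
        norm (block_mult f \<alpha> \<beta>) \<le> K * (norm \<alpha> * norm \<beta>)) \<longleftrightarrow>
      (\<exists>K>0. quasi_multiplicative (e \<circ> r \<circ> s) K)"
    if "strict_mono r" "strict_mono s" for r s :: "nat \<Rightarrow> nat"
    unfolding Let_def using independent_sequence.quasi_multiplicative_iff[OF sub[OF that]] by (intro ex_cong1 conj_cong refl) auto
  \<comment> \<open>The bounds \<open>c\<close> and \<open>S\<close> for the norms of
    \<open>e\<close> serve all subsequences.\<close>
  define c where "c = (INF i. norm (e i))"
  have c: "c > 0" "\<And>i. c \<le> norm (e i)"
    using assms(2) unfolding semi_normalized_def c_def
    by (auto intro!: cINF_lower bdd_belowI2[of _ 0])
  obtain S where S: "\<And>i. norm (e i) \<le> S"
    using assms(2) unfolding semi_normalized_def bdd_above_def by blast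
  show ?thesis
  proof
    assume a: ?a
    show ?b
    proof (intro allI impI)
      fix r :: "nat \<Rightarrow> nat" assume r: "strict_mono r"
      then obtain s :: "nat \<Rightarrow> nat" where s: "strict_mono s"
        and eq: "equivalent_sequences norm (e \<circ> r \<circ> s) c0_norm unit_vector \<or>
          (\<exists>p\<ge>1. equivalent_sequences norm (e \<circ> r \<circ> s) (lp_norm p) unit_vector)"
        using a by blast
      from eq have "\<exists>K>0. quasi_multiplicative (e \<circ> r \<circ> s) K"
      proof (elim disjE exE conjE)
        assume "equivalent_sequences norm (e \<circ> r \<circ> s) c0_norm unit_vector"
        then show ?thesis
          by (rule quasi_multiplicative_if_equivalent[OF _ c0_norm_nonneg c0_norm_tensor]) blast
      next
        fix p :: real assume "equivalent_sequences norm (e \<circ> r \<circ> s) (lp_norm p) unit_vector"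
        then show ?thesis
          by (rule quasi_multiplicative_if_equivalent[OF _ _ lp_norm_tensor]) (auto simp: lp_norm_def)
      qed
      then have "let f = e \<circ> r \<circ> s in
          \<exists>K>0. \<forall>\<alpha>\<in>span (range f). \<forall>\<beta>\<in>span (range f).
            1 / K * (norm \<alpha> * norm \<beta>) \<le> norm (block_mult f \<alpha> \<beta>) \<and>
            norm (block_mult f \<alpha> \<beta>) \<le> K * (norm \<alpha> * norm \<beta>)"
        by (rule b_iff[OF r s, THEN iffD2])
      with s show "\<exists>s :: nat \<Rightarrow> nat. strict_mono s \<and> (let f = e \<circ> r \<circ> s in
          \<exists>K>0. \<forall>\<alpha>\<in>span (range f). \<forall>\<beta>\<in>span (range f).
            1 / K * (norm \<alpha> * norm \<beta>) \<le> norm (block_mult f \<alpha> \<beta>) \<and>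
            norm (block_mult f \<alpha> \<beta>) \<le> K * (norm \<alpha> * norm \<beta>))"
        by (intro exI[of _ s] conjI)
    qed
  next
    assume b: ?b
    show ?a
    proof (intro allI impI)
      fix r :: "nat \<Rightarrow> nat" assume r: "strict_mono r"
      \<comment> \<open>Stabilisation comes first, and (b) is applied to the stabilised subsequence:
        stability passes to the further subsequence chosen by (b), whereas the estimate for products
        is tied to the indexing of that subsequence.\<close>
      obtain u where u: "strict_mono u" "spread_stable (e \<circ> r \<circ> u)"
        using spread_stable_subsequence_exists[of "e \<circ> r" S] S by auto
      have ru: "strict_mono (r \<circ> u)" using r u(1) by (rule strict_mono_o)
      with b obtain s where s: "strict_mono s" and "let f = e \<circ> (r \<circ> u) \<circ> s in
          \<exists>K>0. \<forall>\<alpha>\<in>span (range f). \<forall>\<beta>\<in>span (range f).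
            1 / K * (norm \<alpha> * norm \<beta>) \<le> norm (block_mult f \<alpha> \<beta>) \<and>
            norm (block_mult f \<alpha> \<beta>) \<le> K * (norm \<alpha> * norm \<beta>)"
        by blast
      then obtain K where K: "K > 0" "quasi_multiplicative (e \<circ> (r \<circ> u) \<circ> s) K"
        using b_iff[OF ru s] by blast
      have "spread_stable (e \<circ> (r \<circ> u) \<circ> s)"
        using spread_stable_subseq[OF u(2) s] by (simp add: comp_assoc)
      then interpret quasi_multiplicative_sequence "e \<circ> (r \<circ> u) \<circ> s" K c S
        using sub[OF ru s] K c S
        by (simp add: quasi_multiplicative_sequence_def quasi_multiplicative_sequence_axioms_def)
      show "\<exists>s :: nat \<Rightarrow> nat. strict_mono s \<and>
        (equivalent_sequences norm (e \<circ> r \<circ> s) c0_norm unit_vector \<or>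
         (\<exists>p\<ge>1. equivalent_sequences norm (e \<circ> r \<circ> s) (lp_norm p) unit_vector))"
        using equivalent_c0_or_lp strict_mono_o[OF u(1) s]
        by (intro exI[of _ "u \<circ> s"]) (simp add: comp_assoc)
    qed
  qed
qed

end
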